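(* Let $\alpha\in(1,2)$ and $1/\alpha<H<1$. Let $\{X_{H,\alpha}(t)\}_{t\in\mathbb{R}}$ be the symmetric $\alpha$-stable linear fractional stable motion, let $\psi$ be a real-valued continuous function, not identically zero, supported in $[0,1]$, with $\int_{\mathbb{R}}\psi(s)\,ds=\int_{\mathbb{R}}s\psi(s)\,ds=0$, and let $d_{j,k}=2^j\int_{\mathbb{R}}X_{H,\alpha}(t)\psi(2^jt-k)\,dt$ and $D_j=\max_{0\le k<2^j}|d_{j,k}|$. For each integer $j\ge 1$ define $\widehat{\alpha}_j$ by $$\frac{1}{\widehat{\alpha}_j}=H+\frac{\log(D_j)}{j\log(2)}.$$ Then, almost surely, $\widehat{\alpha}_j\to\alpha$ as $j\to+\infty$.
   Context: The linear fractional stable motion is defined for $t\in\mathbb{R}$ by $$X_{H,\alpha}(t)=\int_{\mathbb{R}}\Big\{(t-s)_+^{H-1/\alpha}-(-s)_+^{H-1/\alpha}\Big\}\,Z_\alpha(ds),$$ where $(z)_+=\max\{z,0\}$ and $Z_\alpha$ is a symmetric $\alpha$-stable random measure on $\mathbb{R}$ with Lebesgue control measure (so for $f\in L^\alpha(\mathbb{R})$, $\mathbb{E}\exp(i\theta\int f\,dZ_\alpha)=\exp(-|\theta|^\alpha\int|f(s)|^\alpha ds)$ for all $\theta\in\mathbb{R}$). Since $H>1/\alpha$, this process has a modification with continuous sample paths, and $X_{H,\alpha}$ is identified with this modification, so that the integrals defining $d_{j,k}$ are pathwise integrals. *)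

theory Defs
  imports "HOL-Probability.Probability"
begin

text \<open>
  \<open>Z\<close> is a set function on the Borel sets of finite Lebesgue measure, which are exactly the members
  of \<^term>\<open>fmeasurable lborel\<close>; its values outside this family are irrelevant.  In the last two
  assumptions the exceptional null set may depend on the sequence, and empty sets are allowed.
\<close>

locale sas_random_measure = prob_space M for M :: "'a measure" +
  fixes \<alpha> :: real and Z :: "real set \<Rightarrow> 'a \<Rightarrow> real"
  assumes random_variable_Z:
      "\<And>A. A \<in> fmeasurable lborel \<Longrightarrow> Z A \<in> borel_measurable M"
    and char_Z:
      "\<And>A \<theta>. A \<in> fmeasurable lborel \<Longrightarrow>
        char (distr M borel (Z A)) \<theta> = complex_of_real (exp (- (\<bar>\<theta>\<bar> powr \<alpha>) * measure lborel A))"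
    and independently_scattered:
      "\<And>A I. finite I \<Longrightarrow> A ` I \<subseteq> fmeasurable lborel \<Longrightarrow> disjoint_family_on A (I :: nat set) \<Longrightarrow>
        indep_vars (\<lambda>_. borel) (\<lambda>i. Z (A i)) I"
    and sigma_additive:
      "\<And>B. range B \<subseteq> fmeasurable lborel \<Longrightarrow> disjoint_family B \<Longrightarrow>
        (\<Union>n::nat. B n) \<in> fmeasurable lborel \<Longrightarrow>
        AE \<omega> in M. (\<lambda>n. Z (B n) \<omega>) sums Z (\<Union>n. B n) \<omega>"

text \<open>
  Meant for simple functions \<open>s\<close> with support of finite Lebesgue measure: then only the level set
  of \<open>0\<close> lies outside \<^term>\<open>fmeasurable lborel\<close>, and its summand vanishes.
\<close>

definition simple_stable_integral :: "(real set \<Rightarrow> 'a \<Rightarrow> real) \<Rightarrow> (real \<Rightarrow> real) \<Rightarrow> 'a \<Rightarrow> real"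
  where "simple_stable_integral Z s \<omega> = (\<Sum>y\<in>range s. y * Z (s -` {y}) \<omega>)"

definition tendsto_in_prob :: "'a measure \<Rightarrow> (nat \<Rightarrow> 'a \<Rightarrow> real) \<Rightarrow> ('a \<Rightarrow> real) \<Rightarrow> bool"
  where "tendsto_in_prob M Y Y' \<longleftrightarrow>
    (\<forall>\<epsilon>>0. (\<lambda>n. measure M {\<omega> \<in> space M. \<epsilon> < \<bar>Y n \<omega> - Y' \<omega>\<bar>}) \<longlonglongrightarrow> 0)"

text \<open>
  \<open>Y\<close> is a version of \<open>\<integral>f dZ\<close>: the limit in probability of the integrals of simple functions that
  converge to \<open>f\<close> in \<open>L\<^sup>\<alpha>\<close> (this forces \<open>f \<in> L\<^sup>\<alpha>\<close>).  The integral is only determined up to null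
  sets, hence a relation rather than a function.
\<close>

definition has_stable_integral ::
    "'a measure \<Rightarrow> real \<Rightarrow> (real set \<Rightarrow> 'a \<Rightarrow> real) \<Rightarrow> (real \<Rightarrow> real) \<Rightarrow> ('a \<Rightarrow> real) \<Rightarrow> bool"
  where "has_stable_integral M \<alpha> Z f Y \<longleftrightarrow>
    f \<in> borel_measurable borel \<and> Y \<in> borel_measurable M \<and>
    (\<exists>s. (\<forall>n. simple_function lborel (s n) \<and> emeasure lborel {x. s n x \<noteq> 0} < \<infinity>) \<and>
         (\<lambda>n. \<integral>\<^sup>+x. ennreal (\<bar>s n x - f x\<bar> powr \<alpha>) \<partial>lborel) \<longlonglongrightarrow> 0 \<and>
         tendsto_in_prob M (\<lambda>n. simple_stable_integral Z (s n)) Y)"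

text \<open>For \<open>H > 1/\<alpha>\<close> the exponent is positive, so \<^term>\<open>0 powr (H - 1/\<alpha>) = (0::real)\<close> is the usual value.\<close>

definition lfsm_kernel :: "real \<Rightarrow> real \<Rightarrow> real \<Rightarrow> real \<Rightarrow> real"
  where "lfsm_kernel H \<alpha> t s = max (t - s) 0 powr (H - 1 / \<alpha>) - max (- s) 0 powr (H - 1 / \<alpha>)"

text \<open>The modification of the linear fractional stable motion with continuous sample paths.\<close>

definition continuous_lfsm ::
    "'a measure \<Rightarrow> real \<Rightarrow> real \<Rightarrow> (real set \<Rightarrow> 'a \<Rightarrow> real) \<Rightarrow> (real \<Rightarrow> 'a \<Rightarrow> real) \<Rightarrow> bool"
  where "continuous_lfsm M H \<alpha> Z X \<longleftrightarrow>
    (\<forall>t. has_stable_integral M \<alpha> Z (lfsm_kernel H \<alpha> t) (X t)) \<and>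
    (\<forall>\<omega>\<in>space M. continuous_on UNIV (\<lambda>t. X t \<omega>))"

definition wavelet_coeff ::
    "(real \<Rightarrow> 'a \<Rightarrow> real) \<Rightarrow> (real \<Rightarrow> real) \<Rightarrow> nat \<Rightarrow> nat \<Rightarrow> 'a \<Rightarrow> real"
  where "wavelet_coeff X \<psi> j k \<omega> = 2 ^ j * (\<integral>t. X t \<omega> * \<psi> (2 ^ j * t - real k) \<partial>lborel)"

definition max_coeff :: "(real \<Rightarrow> 'a \<Rightarrow> real) \<Rightarrow> (real \<Rightarrow> real) \<Rightarrow> nat \<Rightarrow> 'a \<Rightarrow> real"
  where "max_coeff X \<psi> j \<omega> = Max ((\<lambda>k. \<bar>wavelet_coeff X \<psi> j k \<omega>\<bar>) ` {0..<2 ^ j})"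

text \<open>
  Meaningful for \<open>j \<ge> 1\<close>.  In the degenerate case of a vanishing maximum, \<^term>\<open>ln (0::real)\<close> is
  \<open>0\<close>; likewise the value is \<open>0\<close> where the defining equation would require \<open>1 / alpha_hat = 0\<close>.
\<close>

definition alpha_hat :: "real \<Rightarrow> (real \<Rightarrow> 'a \<Rightarrow> real) \<Rightarrow> (real \<Rightarrow> real) \<Rightarrow> nat \<Rightarrow> 'a \<Rightarrow> real"
  where "alpha_hat H X \<psi> j \<omega> = 1 / (H + ln (max_coeff X \<psi> j \<omega>) / (real j * ln 2))"

end

theory Submission
  imports Defs "HOL-Real_Asymp.Real_Asymp"
begin

text \<open>
  Put \<open>\<gamma> = H - 1/\<alpha>\<close> and let \<open>\<Psi>(x) = \<integral> (y - x)\<^sub>+ powr \<gamma> * \<psi>(y) dy\<close>. Approximating the pathwise integral by Riemann sums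
  gives \<open>d\<^sub>j\<^sub>k = 2 powr (- j \<gamma>) * \<integral> \<Psi>(2 ^ j s - k) dZ(s)\<close>, an \<open>\<alpha>\<close>-stable variable of scale \<open>2 powr (- j H)\<close> up to a constant.
  Its tail \<open>P(\<bar>d\<^sub>j\<^sub>k\<bar> > r)\<close> is of order \<open>2 powr (- j \<alpha> H) * r powr - \<alpha>\<close>, so the union bound over the \<open>2 ^ j\<close> coefficients
  and Borel-Cantelli show that \<open>D\<^sub>j \<le> 2 powr (j (\<epsilon> - \<gamma>))\<close> eventually.

  For the lower bound, the vanishing moments give \<open>\<bar>\<Psi>(x)\<bar> = O(\<bar>x\<bar> powr (\<gamma> - 2))\<close> at \<open>- \<infinity>\<close>. Hence the coefficients with
  \<open>k\<close> a multiple of \<open>2 ^ l\<close>, where \<open>l\<close> is about \<open>\<delta> j\<close>, are independent up to small remainders, and the probability that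
  all of them stay below \<open>2 powr (- j (\<gamma> + \<epsilon>))\<close> is summable. So \<open>log D\<^sub>j / (j log 2)\<close> tends to \<open>- \<gamma>\<close>, and its sum with
  \<open>H\<close> tends to \<open>1/\<alpha>\<close>.
\<close>

subsection \<open>Tails of symmetric stable variables\<close>

text \<open>The law of a general stable integral is never identified. Characteristic functions are
  computed for simple functions only, where independence makes them explicit; tail bounds and
  approximate independence are then carried over by approximation in \<open>L^\<alpha>\<close> and
  in probability. Each transfer costs a numerical factor, which is harmless because only the
  exponential rate of the maximum in \<open>j\<close> matters. The tail bounds themselves use the
  characteristic function at frequencies at most of order \<open>1 / r\<close>, not stable
  densities. The obstacle in the lower bound is that the kernel has unbounded support to the left,
  so no two coefficients need be independent. Cutting each sampled kernel to a window of rescaled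
  length \<open>2 ^ l\<close> makes the main parts exactly independent. Long windows make the
  remainders small but leave few parts. A single coefficient exceeds
  \<open>2 powr (- j (\<gamma> + \<epsilon>))\<close> with probability of order
  \<open>2 powr (j (\<alpha> \<epsilon> - 1))\<close>, so clearly more than
  \<open>2 powr (j (1 - \<alpha> \<epsilon>))\<close> independent parts must survive; this dictates
  the size of \<open>l\<close>. The lower tail also needs a positive scale, that is, a kernel that
  does not vanish almost everywhere.\<close>

lemma (in prob_space) expectation_cos_char:
  assumes [measurable]: "Y \<in> borel_measurable M" and "char (distr M borel Y) u = complex_of_real r"
  shows "expectation (\<lambda>\<omega>. cos (u * Y \<omega>)) = r"
proof -
  have "complex_of_real r = (CLINT \<omega>|M. iexp (u * Y \<omega>))"
    using assms(2) unfolding char_def by (subst (asm) integral_distr) auto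
  hence "r = Re (CLINT \<omega>|M. iexp (u * Y \<omega>))" by (metis Re_complex_of_real)
  also have "\<dots> = expectation (\<lambda>\<omega>. Re (iexp (u * Y \<omega>)))"
    by (intro integral_Re[symmetric] integrable_iexp) auto
  also have "\<dots> = expectation (\<lambda>\<omega>. cos (u * Y \<omega>))" by (simp add: Re_exp)
  finally show ?thesis by simp
qed

lemma (in prob_space) integrable_one_minus_cos:
  fixes Y :: "'a \<Rightarrow> real"
  assumes [measurable]: "Y \<in> borel_measurable M"
  shows "integrable M (\<lambda>\<omega>. 1 - cos (u * Y \<omega>))"
proof (intro integrable_const_bound[where B = 2] AE_I2)
  show "norm (1 - cos (u * Y x)) \<le> 2" for x :: 'a
    using cos_le_one[of "u * Y x"] cos_ge_minus_one[of "u * Y x"]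
    unfolding real_norm_def by linarith
qed measurable

lemma nn_integral_one_minus_cos:
  fixes x :: real
  assumes "x \<noteq> 0"
  shows "(\<integral>\<^sup>+v. ennreal (1 - cos (v * x)) * indicator {0..1} v \<partial>lborel) = ennreal (1 - sin x / x)"
proof -
  have "((\<lambda>v. v - sin (v * x) / x) has_real_derivative 1 - cos (v * x)) (at v)" for v
    using assms by (auto intro!: derivative_eq_intros)
  then show ?thesis
    by (subst nn_integral_FTC_Icc[where F = "\<lambda>v. v - sin (v * x) / x"])
       (auto simp: has_real_derivative_iff_has_vector_derivative)
qed

lemma sin_over_le_half:
  fixes x :: real
  assumes "2 \<le> \<bar>x\<bar>"
  shows "1 / 2 \<le> 1 - sin x / x"
proof -
  have "\<bar>sin x / x\<bar> \<le> 1 / 2"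
    using assms abs_sin_le_one[of x] by (simp add: abs_divide divide_simps; linarith)
  thus ?thesis by linarith
qed

lemma one_minus_cos_le: "1 - cos x \<le> x\<^sup>2 / 2" for x :: real
proof -
  have "(sin (x / 2))\<^sup>2 \<le> (x / 2)\<^sup>2"
    using abs_sin_x_le_abs_x[of "x / 2"] abs_le_square_iff by blast
  thus ?thesis using cos_double_sin[of "x / 2"] by (simp add: power_divide)
qed

text \<open>Averaging \<open>1 - cos (v Y)\<close> over the frequencies \<open>0 \<le> v \<le> 2 / r\<close> dominates half the tail indicator.\<close>

lemma (in prob_space) stable_tail_upper:
  assumes Y[measurable]: "Y \<in> borel_measurable M"
    and ch: "\<And>\<theta>. char (distr M borel Y) \<theta> = complex_of_real (exp (- (\<bar>\<theta>\<bar> powr \<alpha>) * S))"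
    and "0 < \<alpha>" "\<alpha> \<le> 2" "0 \<le> S" "0 < r"
  shows "prob {\<omega>\<in>space M. r < \<bar>Y \<omega>\<bar>} \<le> 8 * S / r powr \<alpha>"
proof -
  define u where "u = 2 / r"
  have u: "u > 0" using assms by (simp add: u_def)
  interpret L: sigma_finite_measure lborel by (rule sigma_finite_lborel)
  interpret P: pair_sigma_finite lborel M ..
  have 1: "(\<integral>\<^sup>+v. (\<integral>\<^sup>+\<omega>. ennreal (1 - cos (v * (u * Y \<omega>))) * indicator {0..1} v \<partial>M) \<partial>lborel)
     = (\<integral>\<^sup>+\<omega>. (\<integral>\<^sup>+v. ennreal (1 - cos (v * (u * Y \<omega>))) * indicator {0..1} v \<partial>lborel) \<partial>M)"
    by (rule P.Fubini'[symmetric]) measurable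
  have bd: "(\<integral>\<^sup>+\<omega>. ennreal (1 - cos (v * (u * Y \<omega>))) * indicator {0..1} v \<partial>M) \<le> ennreal (u powr \<alpha> * S) * indicator {0..1} v" for v
  proof (cases "v \<in> {0..1}")
    case True
    have "(\<integral>\<^sup>+\<omega>. ennreal (1 - cos (v * (u * Y \<omega>))) \<partial>M) = ennreal (expectation (\<lambda>\<omega>. 1 - cos (v * u * Y \<omega>)))"
      by (subst nn_integral_eq_integral[symmetric]) (auto intro!: integrable_one_minus_cos simp: mult_ac)
    also have "expectation (\<lambda>\<omega>. 1 - cos (v * u * Y \<omega>)) = 1 - expectation (\<lambda>\<omega>. cos (v * u * Y \<omega>))"
      by (subst Bochner_Integration.integral_diff) (auto intro!: integrable_const_bound[where B = 1] simp: prob_space)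
    also have "expectation (\<lambda>\<omega>. cos (v * u * Y \<omega>)) = exp (- (\<bar>v * u\<bar> powr \<alpha>) * S)"
      by (rule expectation_cos_char[OF Y ch])
    also have "1 - exp (- (\<bar>v * u\<bar> powr \<alpha>) * S) \<le> (\<bar>v * u\<bar> powr \<alpha>) * S"
      using exp_ge_add_one_self[of "- (\<bar>v * u\<bar> powr \<alpha>) * S"] by linarith
    also have "\<dots> \<le> u powr \<alpha> * S"
      using True u assms by (intro mult_right_mono powr_mono2) (auto simp: abs_mult mult_le_cancel_right1)
    finally show ?thesis using True by (simp add: ennreal_leI)
  qed auto
  have "(\<integral>\<^sup>+v. (\<integral>\<^sup>+\<omega>. ennreal (1 - cos (v * (u * Y \<omega>))) * indicator {0..1} v \<partial>M) \<partial>lborel)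
     \<le> (\<integral>\<^sup>+v. ennreal (u powr \<alpha> * S) * indicator {0..1::real} v \<partial>lborel)"
    by (rule nn_integral_mono) (rule bd)
  also have "\<dots> = ennreal (u powr \<alpha> * S)" by (subst nn_integral_cmult_indicator) auto
  finally have 2: "(\<integral>\<^sup>+\<omega>. (\<integral>\<^sup>+v. ennreal (1 - cos (v * (u * Y \<omega>))) * indicator {0..1} v \<partial>lborel) \<partial>M) \<le> ennreal (u powr \<alpha> * S)"
    unfolding 1 .
  let ?E = "{\<omega>\<in>space M. r < \<bar>Y \<omega>\<bar>}"
  have "ennreal (1/2 * prob ?E) = (\<integral>\<^sup>+\<omega>. ennreal (1/2) * indicator ?E \<omega> \<partial>M)"
    by (subst nn_integral_cmult_indicator) (auto simp: emeasure_eq_measure ennreal_mult'[symmetric] simp del: ennreal_half)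
  also have "\<dots> \<le> (\<integral>\<^sup>+\<omega>. (\<integral>\<^sup>+v. ennreal (1 - cos (v * (u * Y \<omega>))) * indicator {0..1} v \<partial>lborel) \<partial>M)"
  proof (intro nn_integral_mono)
    fix \<omega> assume "\<omega> \<in> space M"
    show "ennreal (1/2) * indicator ?E \<omega> \<le> (\<integral>\<^sup>+v. ennreal (1 - cos (v * (u * Y \<omega>))) * indicator {0..1} v \<partial>lborel)"
    proof (cases "\<omega> \<in> ?E")
      case True
      hence "2 \<le> \<bar>u * Y \<omega>\<bar>" using assms by (auto simp: u_def abs_mult field_simps)
      from sin_over_le_half[OF this] show ?thesis using True u \<open>2 \<le> \<bar>u * Y \<omega>\<bar>\<close>
        by (subst nn_integral_one_minus_cos) (auto simp del: ennreal_half intro!: ennreal_leI)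
    qed auto
  qed
  also note 2
  finally have "1/2 * prob ?E \<le> u powr \<alpha> * S" using assms by (subst (asm) ennreal_le_iff) auto
  \<comment> \<open>The constant 8 of the conclusion is \<open>2 * 4\<close>: a factor 2 for the
    half in front of the indicator, and \<open>2 powr \<alpha> \<le> 4\<close> from the frequency
    \<open>u = 2 / r\<close>.\<close>
  also have "u powr \<alpha> * S = 2 powr \<alpha> * S / r powr \<alpha>" using assms by (simp add: u_def powr_divide)
  also have "\<dots> \<le> 4 * S / r powr \<alpha>"
    using assms powr_mono[of \<alpha> 2 2] by (intro divide_right_mono mult_right_mono) auto
  finally show ?thesis by simp
qed

text \<open>
  The identity \<open>4 (1 - cos x) - (1 - cos 2x) = 2 (1 - cos x)\<^sup>2\<close> produces a function that is of fourth
  order at \<open>0\<close>, so the event \<open>\<bar>Y\<bar> \<le> r\<close> contributes negligibly, while \<open>4 - 2 powr \<alpha> > 0\<close>.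
\<close>

lemma (in prob_space) stable_tail_lower:
  assumes Y[measurable]: "Y \<in> borel_measurable M"
    and ch: "\<And>\<theta>. char (distr M borel Y) \<theta> = complex_of_real (exp (- (\<bar>\<theta>\<bar> powr \<alpha>) * S))"
    and \<alpha>: "0 < \<alpha>" "\<alpha> < 2" and "0 < a" "a \<le> S" "0 < r"
  defines "\<tau> \<equiv> 4 - 2 powr \<alpha>"
  assumes small: "a / r powr \<alpha> \<le> \<tau> / 8"
  shows "\<tau> / 32 * (\<tau> / 4) powr (\<alpha> / 2) * (a / r powr \<alpha>) \<le> prob {\<omega>\<in>space M. r < \<bar>Y \<omega>\<bar>}"
proof -
  have \<tau>: "0 < \<tau>" "\<tau> < 4"
    using \<alpha> powr_less_mono[of \<alpha> 2 2] by (auto simp: \<tau>_def)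
  define \<eta> where "\<eta> = sqrt (\<tau> / 4)"
  have \<eta>: "0 < \<eta>" "\<eta>\<^sup>2 = \<tau> / 4" using \<tau> by (auto simp: \<eta>_def)
  have \<eta>1: "\<eta> \<le> 1" using \<tau> by (auto simp: \<eta>_def)
  have \<eta>p: "\<eta> powr \<alpha> = (\<tau> / 4) powr (\<alpha> / 2)"
    using \<tau> by (simp add: \<eta>_def powr_half_sqrt[symmetric] powr_powr)
  define w where "w = \<eta> powr \<alpha> * (a / r powr \<alpha>)"
  have w0: "w > 0" using \<eta> assms by (simp add: w_def)
  have "w \<le> 1 * (a / r powr \<alpha>)" unfolding w_def
    using \<eta> \<eta>1 \<alpha> assms by (intro mult_right_mono) (auto simp: powr_le1)
  hence w1: "w \<le> \<tau> / 8" using small by linarith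
  \<comment> \<open>The frequency is solved from the desired exponent
    \<open>w = u powr \<alpha> * S\<close>. Only \<open>a \<le> S\<close> is known, and a larger
    \<open>S\<close> merely lowers the frequency, so \<open>u \<le> \<eta> / r\<close> holds in
    every case.\<close>
  define u where "u = (w / S) powr (1 / \<alpha>)"
  have u0: "u > 0" using w0 assms by (simp add: u_def)
  have uS: "u powr \<alpha> * S = w" using w0 assms by (simp add: u_def powr_powr)
  have "u \<le> (\<eta> powr \<alpha> * (1 / r powr \<alpha>)) powr (1 / \<alpha>)"
    unfolding u_def w_def using assms w0 \<eta> by (intro powr_mono2) (auto simp: field_simps intro!: mult_left_mono)
  also have "\<dots> = \<eta> / r"
    using assms \<eta> by (simp add: powr_divide[symmetric] powr_powr)
  finally have ul: "u \<le> \<eta> / r" .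
  let ?E = "{\<omega>\<in>space M. r < \<bar>Y \<omega>\<bar>}"
  let ?f = "\<lambda>v \<omega>. 1 - cos (v * Y \<omega>)"
  have int: "integrable M (?f v)" for v by (rule integrable_one_minus_cos) fact
  have E: "expectation (?f v) = 1 - exp (- (\<bar>v\<bar> powr \<alpha>) * S)" for v
    using expectation_cos_char[OF Y ch, of v]
    by (subst Bochner_Integration.integral_diff) (auto intro!: integrable_const_bound[where B = 1] simp: prob_space)
  \<comment> \<open>Lowering the coefficient 4 to \<open>4 - \<eta>\<^sup>2\<close> turns the
    nonnegative function \<open>2 (1 - c)^2\<close> into one that is at most 0 wherever
    \<open>u * \<bar>Y \<omega>\<bar> \<le> \<eta>\<close>, in particular off \<open>?E\<close>. On
    \<open>?E\<close> the crude bound 8 suffices.\<close>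
  have pt: "(4 - \<eta>\<^sup>2) * ?f u \<omega> - ?f (2 * u) \<omega> \<le> 8 * indicator ?E \<omega>" if "\<omega> \<in> space M" for \<omega>
  proof -
    define c where "c = cos (u * Y \<omega>)"
    have c: "-1 \<le> c" "c \<le> 1" by (auto simp: c_def)
    have "cos (2 * u * Y \<omega>) = 2 * c\<^sup>2 - 1" using cos_double_cos[of "u * Y \<omega>"] by (simp add: c_def mult_ac)
    hence eq: "(4 - \<eta>\<^sup>2) * ?f u \<omega> - ?f (2 * u) \<omega> = (1 - c) * (2 * (1 - c) - \<eta>\<^sup>2)"
      by (simp add: c_def[symmetric] algebra_simps power2_eq_square)
    show ?thesis
    proof (cases "\<omega> \<in> ?E")
      case True
      have "(1 - c) * (2 * (1 - c) - \<eta>\<^sup>2) \<le> (1 - c) * 4"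
        proof (rule mult_left_mono)
        have "- 2 \<le> 2 * c" using c(1) by simp
        thus "2 * (1 - c) - \<eta>\<^sup>2 \<le> 4" using zero_le_power2[of \<eta>] unfolding right_diff_distrib by linarith
        show "0 \<le> 1 - c" using c(2) by simp
      qed
      with True c eq show ?thesis by (simp del: mult_le_cancel_left)
    next
      case False
      hence Yl: "\<bar>Y \<omega>\<bar> \<le> r" using that by auto
      have "\<bar>u * Y \<omega>\<bar> \<le> (\<eta> / r) * r" unfolding abs_mult using ul u0 Yl by (intro mult_mono) auto
      hence "\<bar>u * Y \<omega>\<bar> \<le> \<eta>" using assms by simp
      hence "(u * Y \<omega>)\<^sup>2 \<le> \<eta>\<^sup>2" using \<eta> by (simp add: abs_le_square_iff[symmetric])
      moreover have "1 - c \<le> (u * Y \<omega>)\<^sup>2 / 2"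
        using one_minus_cos_le[of "u * Y \<omega>"] by (simp add: c_def)
      ultimately have "2 * (1 - c) - \<eta>\<^sup>2 \<le> 0" by simp
      hence "(1 - c) * (2 * (1 - c) - \<eta>\<^sup>2) \<le> 0" using c by (intro mult_nonneg_nonpos) auto
      thus ?thesis using eq False by simp
    qed
  qed
  have "(4 - \<eta>\<^sup>2) * (1 - exp (- w)) - (1 - exp (- (2 powr \<alpha>) * w))
      = (4 - \<eta>\<^sup>2) * expectation (?f u) - expectation (?f (2 * u))"
    unfolding E using u0 uS by (simp add: abs_mult powr_mult mult_ac)
  also have "\<dots> = expectation (\<lambda>\<omega>. (4 - \<eta>\<^sup>2) * ?f u \<omega> - ?f (2 * u) \<omega>)"
    using int by simp
  also have "\<dots> \<le> expectation (\<lambda>\<omega>. 8 * indicator ?E \<omega>)"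
    using int pt by (intro integral_mono) (auto intro!: integrable_real_mult_indicator simp: emeasure_eq_measure)
  also have "\<dots> = 8 * prob ?E" by simp
  finally have main: "(4 - \<eta>\<^sup>2) * (1 - exp (- w)) - (1 - exp (- (2 powr \<alpha>) * w)) \<le> 8 * prob ?E" .
  have e1: "w - w\<^sup>2 \<le> 1 - exp (- w)"
  proof -
    have "exp (- w) * (1 + w) \<le> exp (- w) * exp w"
      by (intro mult_left_mono exp_ge_add_one_self) auto
    hence "exp (- w) \<le> 1 / (1 + w)" using w0 by (simp add: exp_minus field_simps)
    also have "\<dots> \<le> 1 - w + w\<^sup>2" using w0 by (simp add: field_simps power2_eq_square)
    finally show ?thesis by simp
  qed
  have e2: "1 - exp (- (2 powr \<alpha>) * w) \<le> 2 powr \<alpha> * w"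
    using exp_ge_add_one_self[of "- (2 powr \<alpha>) * w"] by linarith
  \<comment> \<open>The constant part \<open>4 - \<eta>\<^sup>2 - 2 powr \<alpha>\<close> equals
    \<open>3 \<tau> / 4\<close>, and \<open>w \<le> \<tau> / 8\<close> costs at most
    \<open>\<tau> / 2\<close>. This is where the smallness assumption enters.\<close>
  have "w * (\<tau> / 4) \<le> w * (4 - \<eta>\<^sup>2 - 4 * w - 2 powr \<alpha>)"
    using w0 w1 \<eta> by (intro mult_left_mono) (auto simp: \<tau>_def)
  also have "\<dots> \<le> (4 - \<eta>\<^sup>2) * (w - w\<^sup>2) - 2 powr \<alpha> * w"
    using w0 \<eta> by (simp add: algebra_simps power2_eq_square)
  also have "\<dots> \<le> (4 - \<eta>\<^sup>2) * (1 - exp (- w)) - (1 - exp (- (2 powr \<alpha>) * w))"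
    using \<eta>(2) \<tau>(2) by (intro diff_mono mult_left_mono e1 e2) simp
  finally have "w * (\<tau> / 4) \<le> 8 * prob ?E" using main by linarith
  moreover have "\<tau> / 32 * (\<tau> / 4) powr (\<alpha> / 2) * (a / r powr \<alpha>) = w * (\<tau> / 4) / 8"
    by (simp add: w_def \<eta>p)
  ultimately show ?thesis by linarith
qed

subsection \<open>Stable integrals of simple functions\<close>

text \<open>Packages the condition that \<open>has_stable_integral\<close> puts on its approximants,
  as a class closed under linear combinations and restriction to Borel sets.\<close>

definition simple_finite :: "(real \<Rightarrow> real) \<Rightarrow> bool"
  where "simple_finite s \<longleftrightarrow> simple_function lborel s \<and> emeasure lborel {x. s x \<noteq> 0} < \<infinity>"

text \<open>Left without the root and extended-valued: for \<open>p = \<alpha>\<close> this is the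
  coefficient in the exponent of the characteristic function, and no integrability conditions have
  to be carried along.\<close>

definition lpow :: "real \<Rightarrow> (real \<Rightarrow> real) \<Rightarrow> ennreal"
  where "lpow p f = (\<integral>\<^sup>+x. ennreal (\<bar>f x\<bar> powr p) \<partial>lborel)"

lemma simple_finiteD:
  assumes "simple_finite s"
  shows "finite (range s)" "s -` A \<in> sets borel" "s \<in> borel_measurable borel"
    "y \<noteq> 0 \<Longrightarrow> s -` {y} \<in> fmeasurable lborel"
proof -
  have sf: "simple_function lborel s" using assms by (simp add: simple_finite_def)
  show "finite (range s)" using simple_functionD(1)[OF sf] by simp
  show 1: "s -` A \<in> sets borel" for A using simple_functionD(2)[OF sf, of A] by simp
  show m: "s \<in> borel_measurable borel" using borel_measurable_simple_function[OF sf] by simp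
  show "s -` {y} \<in> fmeasurable lborel" if "y \<noteq> 0"
  proof (rule fmeasurableI)
    show "s -` {y} \<in> sets lborel" using 1 by simp
    have "emeasure lborel (s -` {y}) \<le> emeasure lborel {x. s x \<noteq> 0}"
      using m that by (intro emeasure_mono) auto
    also have "\<dots> < \<infinity>" using assms by (simp add: simple_finite_def)
    finally show "emeasure lborel (s -` {y}) < \<infinity>" .
  qed
qed

lemma simple_finiteI:
  assumes "finite (range s)" and [measurable]: "s \<in> borel_measurable borel"
    and "{x. s x \<noteq> 0} \<subseteq> A" "A \<in> sets borel" "emeasure lborel A < \<infinity>"
  shows "simple_finite s"
  unfolding simple_finite_def
proof
  show "simple_function lborel s" using assms by (intro simple_function_borel_measurable) auto
  show "emeasure lborel {x. s x \<noteq> 0} < \<infinity>"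
    using assms by (auto intro!: le_less_trans[OF emeasure_mono[of _ A lborel]])
qed

lemma simple_finite_0: "simple_finite (\<lambda>_. 0)"
  by (rule simple_finiteI[where A = "{}"]) auto

lemma simple_finite_add:
  assumes "simple_finite s" "simple_finite t"
  shows "simple_finite (\<lambda>x. s x + t x)"
proof -
  note [measurable] = simple_finiteD(3)[OF assms(1)] simple_finiteD(3)[OF assms(2)]
  have "simple_function lborel (\<lambda>x. s x + t x)"
    using assms by (intro simple_function_add) (auto simp: simple_finite_def)
  hence f: "finite (range (\<lambda>x. s x + t x))" using simple_functionD(1) by fastforce
  have "emeasure lborel ({x. s x \<noteq> 0} \<union> {x. t x \<noteq> 0}) \<le> emeasure lborel {x. s x \<noteq> 0} + emeasure lborel {x. t x \<noteq> 0}"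
    by (rule emeasure_subadditive) auto
  also have "\<dots> < \<infinity>" using assms by (auto simp: simple_finite_def)
  finally show ?thesis by (intro simple_finiteI[OF f, where A = "{x. s x \<noteq> 0} \<union> {x. t x \<noteq> 0}"]) auto
qed

lemma simple_finite_cmult:
  assumes "simple_finite s"
  shows "simple_finite (\<lambda>x. c * s x)"
proof -
  note [measurable] = simple_finiteD(3)[OF assms(1)]
  have "finite ((\<lambda>y. c * y) ` range s)" using simple_finiteD(1)[OF assms] by simp
  hence f: "finite (range (\<lambda>x. c * s x))" by (simp add: image_image)
  show ?thesis using assms by (intro simple_finiteI[OF f, where A = "{x. s x \<noteq> 0}"]) (auto simp: simple_finite_def)
qed

lemma simple_finite_indicator:
  assumes "simple_finite s" and [measurable]: "A \<in> sets borel"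
  shows "simple_finite (\<lambda>x. s x * indicator A x)"
proof -
  note [measurable] = simple_finiteD(3)[OF assms(1)]
  have "range (\<lambda>x. s x * indicator A x) \<subseteq> insert 0 (range s)" by (auto simp: indicator_def)
  hence f: "finite (range (\<lambda>x. s x * indicator A x))"
    using simple_finiteD(1)[OF assms(1)] by (meson finite.insertI finite_subset)
  show ?thesis using assms
    by (intro simple_finiteI[OF f, where A = "{x. s x \<noteq> 0}"]) (auto simp: simple_finite_def)
qed

context sas_random_measure begin

abbreviation I :: "(real \<Rightarrow> real) \<Rightarrow> 'a \<Rightarrow> real" where "I \<equiv> simple_stable_integral Z"

text \<open>A convergent series with constant terms has terms 0. Finite additivity is deduced from
  countable additivity by padding with empty sets, so this has to come first.\<close>

lemma AE_Z_empty: "AE \<omega> in M. Z {} \<omega> = 0"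
proof -
  have "AE \<omega> in M. (\<lambda>n. Z ((\<lambda>_::nat. {}) n) \<omega>) sums Z (\<Union>n::nat. {}) \<omega>"
    by (rule sigma_additive) (auto simp: disjoint_family_on_def)
  thus ?thesis
  proof eventually_elim
    case (elim \<omega>)
    hence "(\<lambda>n::nat. Z {} \<omega>) \<longlonglongrightarrow> 0" by (auto dest!: sums_summable summable_LIMSEQ_zero)
    thus ?case by (simp add: LIMSEQ_const_iff)
  qed
qed

lemma AE_Z_Un:
  assumes "A \<in> fmeasurable lborel" "B \<in> fmeasurable lborel" "A \<inter> B = {}"
  shows "AE \<omega> in M. Z (A \<union> B) \<omega> = Z A \<omega> + Z B \<omega>"
proof -
  have "AE \<omega> in M. (\<lambda>n. Z (binaryset A B n) \<omega>) sums Z (\<Union>n. binaryset A B n) \<omega>"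
    using assms by (intro sigma_additive) (auto simp: range_binaryset_eq UN_binaryset_eq disjoint_family_on_def binaryset_def)
  with AE_Z_empty show ?thesis
  proof eventually_elim
    case (elim \<omega>)
    from binaryset_sums[of "\<lambda>S. Z S \<omega>" A B] elim(1)
    have "(\<lambda>n. Z (binaryset A B n) \<omega>) sums (Z A \<omega> + Z B \<omega>)" by simp
    thus ?case using elim(2) sums_unique2 by (fastforce simp: UN_binaryset_eq)
  qed
qed

lemma AE_Z_finite_UN:
  assumes "finite J" "disjoint_family_on A J" "A ` J \<subseteq> fmeasurable lborel"
  shows "AE \<omega> in M. Z (\<Union>i\<in>J. A i) \<omega> = (\<Sum>i\<in>J. Z (A i) \<omega>)"
  using assms
proof (induction J rule: finite_induct)
  case empty
  then show ?case using AE_Z_empty by simp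
next
  case (insert i J)
  have "AE \<omega> in M. Z (\<Union>i\<in>J. A i) \<omega> = (\<Sum>i\<in>J. Z (A i) \<omega>)"
    using insert by (intro insert.IH) (auto simp: disjoint_family_on_def)
  moreover have "AE \<omega> in M. Z (A i \<union> (\<Union>i\<in>J. A i)) \<omega> = Z (A i) \<omega> + Z (\<Union>i\<in>J. A i) \<omega>"
    using insert by (intro AE_Z_Un fmeasurable.finite_UN) (auto simp: disjoint_family_on_def)
  ultimately show ?case
    by eventually_elim (use insert in simp)
qed

text \<open>The locale assumption speaks of families indexed by natural numbers, while level sets
  are indexed by reals or by pairs. An enumeration of the finite index set transports the
  statement.\<close>

lemma indep_Z:
  fixes A :: "'i \<Rightarrow> real set"
  assumes "finite J" "disjoint_family_on A J" "A ` J \<subseteq> fmeasurable lborel"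
  shows "indep_vars (\<lambda>_. borel) (\<lambda>i. Z (A i)) J"
proof -
  define e where "e = to_nat_on J"
  have inj: "inj_on e J" using assms by (simp add: e_def countable_finite inj_on_to_nat_on)
  define B where "B n = A (inv_into J e n)" for n
  have Be: "B (e j) = A j" if "j \<in> J" for j using inj that by (simp add: B_def)
  have 1: "indep_vars (\<lambda>_. borel) (\<lambda>n. Z (B n)) (e ` J)"
  proof (rule independently_scattered)
    show "disjoint_family_on B (e ` J)"
      using assms(2) Be unfolding disjoint_family_on_def by fastforce
  qed (use assms Be in auto)
  \<comment> \<open>Reindexing is done by grouping into the one-element blocks \<open>{e j}\<close>
    and then projecting each block to its only coordinate.\<close>
  have "indep_vars (\<lambda>j. PiM {e j} (\<lambda>_. borel)) (\<lambda>j \<omega>. restrict (\<lambda>n. Z (B n) \<omega>) {e j}) J"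
    using inj by (intro indep_vars_restrict[OF 1]) (auto simp: disjoint_family_on_def inj_on_def)
  from indep_vars_compose2[OF this, where Y = "\<lambda>j f. f (e j)" and N = "\<lambda>_. borel :: real measure"]
  have "indep_vars (\<lambda>_. borel) (\<lambda>j \<omega>. Z (B (e j)) \<omega>) J"
    by (simp add: measurable_component_singleton)
  thus ?thesis by (subst (asm) indep_vars_cong[where Y = "\<lambda>i. Z (A i)" and J = J]) (auto simp: Be)
qed

lemma I_measurable [measurable]:
  assumes "simple_finite s"
  shows "I s \<in> borel_measurable M"
proof -
  have "(\<lambda>\<omega>. y * Z (s -` {y}) \<omega>) \<in> borel_measurable M" for y
    by (cases "y = 0") (auto intro!: borel_measurable_times random_variable_Z simple_finiteD(4) assms)
  thus ?thesis unfolding simple_stable_integral_def by (intro borel_measurable_sum)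
qed

text \<open>The defining sum uses the coarsest partition on which the integrand is constant; finite
  additivity of \<open>Z\<close> allows any finer finite partition, given here by the level sets of
  \<open>g\<close>. The price is an exceptional null set.\<close>

lemma AE_I_refine:
  fixes g :: "real \<Rightarrow> 'b"
  assumes g: "finite (range g)" "\<And>b. g -` {b} \<in> sets borel" and s: "simple_finite (\<lambda>x. h (g x))"
  shows "AE \<omega> in M. I (\<lambda>x. h (g x)) \<omega> = (\<Sum>b\<in>range g. h b * Z (g -` {b}) \<omega>)"
proof -
  let ?s = "\<lambda>x. h (g x)"
  have "AE \<omega> in M. \<forall>y\<in>range ?s. y * Z (?s -` {y}) \<omega> = (\<Sum>b | b \<in> range g \<and> h b = y. h b * Z (g -` {b}) \<omega>)"
  proof (intro AE_finite_allI simple_finiteD[OF s])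
    fix y assume "y \<in> range ?s"
    show "AE \<omega> in M. y * Z (?s -` {y}) \<omega> = (\<Sum>b | b \<in> range g \<and> h b = y. h b * Z (g -` {b}) \<omega>)"
    \<comment> \<open>The level set of 0 may have infinite measure, where nothing is known about
      \<open>Z\<close>; but there both sides carry the factor 0.\<close>
    proof (cases "y = 0")
      case False
      have eq: "?s -` {y} = (\<Union>b\<in>{b. b \<in> range g \<and> h b = y}. g -` {b})" by auto
      have "AE \<omega> in M. Z (\<Union>b\<in>{b. b \<in> range g \<and> h b = y}. g -` {b}) \<omega> = (\<Sum>b | b \<in> range g \<and> h b = y. Z (g -` {b}) \<omega>)"
      proof (rule AE_Z_finite_UN)
        show "finite {b. b \<in> range g \<and> h b = y}" using g by simp
        show "disjoint_family_on (\<lambda>b. g -` {b}) {b. b \<in> range g \<and> h b = y}"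
          by (auto simp: disjoint_family_on_def)
        show "(\<lambda>b. g -` {b}) ` {b. b \<in> range g \<and> h b = y} \<subseteq> fmeasurable lborel"
          using g eq by (auto intro!: fmeasurableI2[OF simple_finiteD(4)[OF s False]])
      qed
      thus ?thesis
        unfolding eq by eventually_elim (auto simp: sum_distrib_left intro!: sum.cong)
    qed simp
  qed
  thus ?thesis
  proof eventually_elim
    case (elim \<omega>)
    have "I ?s \<omega> = (\<Sum>y\<in>range ?s. (\<Sum>b | b \<in> range g \<and> h b = y. h b * Z (g -` {b}) \<omega>))"
      unfolding simple_stable_integral_def using elim by (intro sum.cong) auto
    also have "range ?s = h ` range g" by auto
    finally show ?case using sum.image_gen[OF g(1), of "\<lambda>b. h b * Z (g -` {b}) \<omega>" h] by simp
  qed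
qed

text \<open>The level sets of \<open>(s x, t x)\<close> form a common refinement, on which all three
  integrals are sums over the same pieces.\<close>

lemma AE_I_add:
  assumes "simple_finite s" "simple_finite t"
  shows "AE \<omega> in M. I (\<lambda>x. s x + t x) \<omega> = I s \<omega> + I t \<omega>"
proof -
  let ?g = "\<lambda>x. (s x, t x)"
  have "range ?g \<subseteq> range s \<times> range t" by auto
  hence g: "finite (range ?g)" using simple_finiteD(1)[OF assms(1)] simple_finiteD(1)[OF assms(2)]
    by (meson finite_SigmaI finite_subset)
  have "?g -` {(a, b)} = s -` {a} \<inter> t -` {b}" for a b by auto
  hence g': "?g -` {b} \<in> sets borel" for b
    using simple_finiteD(2)[OF assms(1)] simple_finiteD(2)[OF assms(2)] by (cases b) auto
  from AE_I_refine[OF g g', where h = fst] AE_I_refine[OF g g', where h = snd]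
    AE_I_refine[OF g g', where h = "\<lambda>b. fst b + snd b"] assms simple_finite_add[OF assms]
  have "AE \<omega> in M. I s \<omega> = (\<Sum>b\<in>range ?g. fst b * Z (?g -` {b}) \<omega>)"
    "AE \<omega> in M. I t \<omega> = (\<Sum>b\<in>range ?g. snd b * Z (?g -` {b}) \<omega>)"
    "AE \<omega> in M. I (\<lambda>x. s x + t x) \<omega> = (\<Sum>b\<in>range ?g. (fst b + snd b) * Z (?g -` {b}) \<omega>)"
    by simp_all
  thus ?thesis by eventually_elim (simp only: sum.distrib[symmetric] distrib_right)
qed

lemma I_cmult: "I (\<lambda>x. c * s x) \<omega> = c * I s \<omega>"
proof (cases "c = 0")
  case True
  have "range (\<lambda>x::real. 0::real) = {0}" by auto
  with True show ?thesis by (simp add: simple_stable_integral_def)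
next
  case False
  have "I (\<lambda>x. c * s x) \<omega> = (\<Sum>y\<in>(\<lambda>y. c * y) ` range s. y * Z ((\<lambda>x. c * s x) -` {y}) \<omega>)"
    by (simp add: simple_stable_integral_def image_image)
  also have "\<dots> = (\<Sum>y\<in>range s. c * y * Z ((\<lambda>x. c * s x) -` {c * y}) \<omega>)"
    using False by (subst sum.reindex) (auto simp: inj_on_def)
  also have "\<dots> = (\<Sum>y\<in>range s. c * (y * Z (s -` {y}) \<omega>))"
    using False by (intro sum.cong refl) (simp add: vimage_def mult.assoc)
  finally show ?thesis by (simp add: simple_stable_integral_def sum_distrib_left)
qed

lemma I_nonzero:
  assumes "simple_finite s"
  shows "I s \<omega> = (\<Sum>y\<in>range s - {0}. y * Z (s -` {y}) \<omega>)"
  unfolding simple_stable_integral_def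
  using simple_finiteD(1)[OF assms] by (intro sum.mono_neutral_right) auto

text \<open>The nonzero level sets of all \<open>f k\<close> together form one finite disjoint
  family of sets. Their \<open>Z\<close>-values are jointly independent, and each integral depends
  only on the block belonging to its own \<open>k\<close>.\<close>

lemma indep_I:
  assumes K: "finite K" and f: "\<And>k. k \<in> K \<Longrightarrow> simple_finite (f k)"
    and disj: "disjoint_family_on (\<lambda>k. {x. f k x \<noteq> 0}) K"
  shows "indep_vars (\<lambda>_. borel) (\<lambda>k. I (f k)) K"
proof -
  define J where "J = (SIGMA k:K. range (f k) - {0})"
  define A where "A p = f (fst p) -` {snd p}" for p
  have 1: "indep_vars (\<lambda>_. borel) (\<lambda>p. Z (A p)) J"
  proof (rule indep_Z)
    show "finite J" unfolding J_def using K simple_finiteD(1)[OF f] by auto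
    show "disjoint_family_on A J"
      unfolding disjoint_family_on_def
    proof (intro ballI impI)
      fix p q assume pq: "p \<in> J" "q \<in> J" "p \<noteq> q"
      show "A p \<inter> A q = {}"
      proof (cases "fst p = fst q")
        case True
        with pq(3) show ?thesis by (auto simp: A_def prod_eq_iff)
      next
        case False
        have "fst p \<in> K" "fst q \<in> K" "snd p \<noteq> 0" "snd q \<noteq> 0" using pq by (auto simp: J_def)
        hence "A p \<subseteq> {x. f (fst p) x \<noteq> 0}" "A q \<subseteq> {x. f (fst q) x \<noteq> 0}" by (auto simp: A_def)
        with disjoint_family_onD[OF disj \<open>fst p \<in> K\<close> \<open>fst q \<in> K\<close> False] show ?thesis by blast
      qed
    qed
    show "A ` J \<subseteq> fmeasurable lborel"
      by (auto simp: A_def J_def intro!: simple_finiteD(4)[OF f])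
  qed
  define G where "G k = {k} \<times> (range (f k) - {0})" for k
  have 2: "indep_vars (\<lambda>k. PiM (G k) (\<lambda>_. borel)) (\<lambda>k \<omega>. restrict (\<lambda>p. Z (A p) \<omega>) (G k)) K"
    by (rule indep_vars_restrict[OF 1]) (auto simp: G_def J_def disjoint_family_on_def)
  have "indep_vars (\<lambda>_. borel) (\<lambda>k \<omega>. (\<Sum>p\<in>G k. snd p * restrict (\<lambda>p. Z (A p) \<omega>) (G k) p)) K"
    by (rule indep_vars_compose2[OF 2, where Y = "\<lambda>k f. (\<Sum>p\<in>G k. snd p * f p)"])
       (auto intro!: borel_measurable_sum borel_measurable_times measurable_component_singleton)
  moreover have "(\<Sum>p\<in>G k. snd p * restrict (\<lambda>p. Z (A p) \<omega>) (G k) p) = I (f k) \<omega>" if "k \<in> K" for k \<omega>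
  proof -
    have "(\<Sum>p\<in>G k. snd p * restrict (\<lambda>p. Z (A p) \<omega>) (G k) p) = (\<Sum>p\<in>Pair k ` (range (f k) - {0}). snd p * Z (A p) \<omega>)"
      by (intro sum.cong) (auto simp: G_def)
    also have "\<dots> = I (f k) \<omega>"
      by (subst sum.reindex) (auto simp: I_nonzero[OF f[OF that]] A_def inj_on_def)
    finally show ?thesis .
  qed
  ultimately show ?thesis by (subst indep_vars_cong[OF refl _ refl]) auto
qed

lemma lpow_simple:
  assumes "simple_finite s"
  shows "lpow \<alpha> s = ennreal (\<Sum>y\<in>range s - {0}. \<bar>y\<bar> powr \<alpha> * measure lborel (s -` {y}))"
proof -
  have fin: "finite (range s - {0})" using simple_finiteD(1)[OF assms] by simp
  have "ennreal (\<bar>s x\<bar> powr \<alpha>) = (\<Sum>y\<in>range s - {0}. ennreal (\<bar>y\<bar> powr \<alpha>) * indicator (s -` {y}) x)" for x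
  proof -
    have "(\<Sum>y\<in>range s - {0}. ennreal (\<bar>y\<bar> powr \<alpha>) * indicator (s -` {y}) x)
       = (\<Sum>y\<in>range s - {0}. if y = s x then ennreal (\<bar>y\<bar> powr \<alpha>) else 0)"
      by (intro sum.cong) (auto simp: indicator_def)
    also have "\<dots> = ennreal (\<bar>s x\<bar> powr \<alpha>)" using fin by (auto simp: sum.delta)
    finally show ?thesis by simp
  qed
  hence "lpow \<alpha> s = (\<integral>\<^sup>+x. (\<Sum>y\<in>range s - {0}. ennreal (\<bar>y\<bar> powr \<alpha>) * indicator (s -` {y}) x) \<partial>lborel)"
    by (simp add: lpow_def)
  also have "\<dots> = (\<Sum>y\<in>range s - {0}. \<integral>\<^sup>+x. ennreal (\<bar>y\<bar> powr \<alpha>) * indicator (s -` {y}) x \<partial>lborel)"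
    using simple_finiteD(2)[OF assms] by (intro nn_integral_sum) auto
  also have "\<dots> = (\<Sum>y\<in>range s - {0}. ennreal (\<bar>y\<bar> powr \<alpha> * measure lborel (s -` {y})))"
  proof (intro sum.cong refl)
    fix y assume "y \<in> range s - {0}"
    hence "s -` {y} \<in> fmeasurable lborel" using simple_finiteD(4)[OF assms] by auto
    thus "(\<integral>\<^sup>+x. ennreal (\<bar>y\<bar> powr \<alpha>) * indicator (s -` {y}) x \<partial>lborel) = ennreal (\<bar>y\<bar> powr \<alpha> * measure lborel (s -` {y}))"
      using simple_finiteD(2)[OF assms]
      by (subst nn_integral_cmult_indicator) (auto simp: ennreal_mult emeasure_eq_measure2)
  qed
  also have "\<dots> = ennreal (\<Sum>y\<in>range s - {0}. \<bar>y\<bar> powr \<alpha> * measure lborel (s -` {y}))"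
    by (intro sum_ennreal) auto
  finally show ?thesis .
qed

lemma char_I:
  assumes "simple_finite s"
  shows "char (distr M borel (I s)) \<theta> = complex_of_real (exp (- (\<bar>\<theta>\<bar> powr \<alpha>) * enn2real (lpow \<alpha> s)))"
proof -
  let ?J = "range s - {0}"
  have fin: "finite ?J" using simple_finiteD(1)[OF assms] by simp
  have "indep_vars (\<lambda>_. borel) (\<lambda>y. Z (s -` {y})) ?J"
    by (rule indep_Z[OF fin]) (auto simp: disjoint_family_on_def intro!: simple_finiteD(4)[OF assms])
  from indep_vars_compose2[OF this, where Y = "\<lambda>y z. y * z" and N = "\<lambda>_. borel"]
  have ind: "indep_vars (\<lambda>_. borel) (\<lambda>y \<omega>. y * Z (s -` {y}) \<omega>) ?J" by simp
  have "I s = (\<lambda>\<omega>. \<Sum>y\<in>?J. y * Z (s -` {y}) \<omega>)" using I_nonzero[OF assms] by auto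
  hence "char (distr M borel (I s)) \<theta> = (\<Prod>y\<in>?J. char (distr M borel (\<lambda>\<omega>. y * Z (s -` {y}) \<omega>)) \<theta>)"
    using char_distr_sum[OF ind] by simp
  also have "\<dots> = (\<Prod>y\<in>?J. complex_of_real (exp (- (\<bar>\<theta>\<bar> powr \<alpha>) * (\<bar>y\<bar> powr \<alpha> * measure lborel (s -` {y})))))"
  proof (intro prod.cong refl)
    fix y assume y: "y \<in> ?J"
    hence fm: "s -` {y} \<in> fmeasurable lborel" using simple_finiteD(4)[OF assms] by auto
    note [measurable] = random_variable_Z[OF fm]
    have "char (distr M borel (\<lambda>\<omega>. y * Z (s -` {y}) \<omega>)) \<theta> = char (distr M borel (Z (s -` {y}))) (\<theta> * y)"
      unfolding char_def by (subst (1 2) integral_distr) (auto simp: mult_ac)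
    also have "\<dots> = complex_of_real (exp (- (\<bar>\<theta>\<bar> powr \<alpha>) * (\<bar>y\<bar> powr \<alpha> * measure lborel (s -` {y}))))"
      unfolding char_Z[OF fm] by (simp add: abs_mult powr_mult mult_ac)
    finally show "char (distr M borel (\<lambda>\<omega>. y * Z (s -` {y}) \<omega>)) \<theta>
       = complex_of_real (exp (- (\<bar>\<theta>\<bar> powr \<alpha>) * (\<bar>y\<bar> powr \<alpha> * measure lborel (s -` {y}))))" .
  qed
  also have "\<dots> = complex_of_real (exp (- (\<bar>\<theta>\<bar> powr \<alpha>) * enn2real (lpow \<alpha> s)))"
  proof -
    have "(\<Prod>y\<in>?J. exp (- (\<bar>\<theta>\<bar> powr \<alpha>) * (\<bar>y\<bar> powr \<alpha> * measure lborel (s -` {y}))))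
      = exp (- (\<bar>\<theta>\<bar> powr \<alpha>) * (\<Sum>y\<in>?J. \<bar>y\<bar> powr \<alpha> * measure lborel (s -` {y})))"
      using fin by (simp only: exp_sum sum_distrib_left)
    moreover have "enn2real (lpow \<alpha> s) = (\<Sum>y\<in>?J. \<bar>y\<bar> powr \<alpha> * measure lborel (s -` {y}))"
      unfolding lpow_simple[OF assms] by (intro enn2real_ennreal sum_nonneg) auto
    ultimately show ?thesis by (simp only: of_real_prod[symmetric])
  qed
  finally show ?thesis .
qed

end

subsection \<open>Approximation by integrals of simple functions\<close>

text \<open>The constant 4 bounds \<open>2 powr p\<close> for all \<open>p \<le> 2\<close>. One
  quasi-triangle inequality then serves every exponent, and it is the source of most factors 4
  below.\<close>

lemma abs_add_powr_le:
  fixes a b p :: real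
  assumes "0 < p" "p \<le> 2"
  shows "\<bar>a + b\<bar> powr p \<le> 4 * (\<bar>a\<bar> powr p + \<bar>b\<bar> powr p)"
proof -
  have "\<bar>a + b\<bar> powr p \<le> (2 * max \<bar>a\<bar> \<bar>b\<bar>) powr p"
    using assms by (intro powr_mono2) auto
  also have "\<dots> = 2 powr p * max \<bar>a\<bar> \<bar>b\<bar> powr p" by (simp add: powr_mult)
  also have "\<dots> \<le> 4 * (\<bar>a\<bar> powr p + \<bar>b\<bar> powr p)"
    using assms powr_mono[of p 2 2] by (intro mult_mono) (auto simp: max_def)
  finally show ?thesis .
qed

lemma lpow_add_le:
  assumes [measurable]: "f \<in> borel_measurable borel" "g \<in> borel_measurable borel" and p: "0 < p" "p \<le> 2"
  shows "lpow p (\<lambda>x. f x + g x) \<le> 4 * (lpow p f + lpow p g)"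
proof -
  have "lpow p (\<lambda>x. f x + g x) \<le> (\<integral>\<^sup>+x. 4 * (ennreal (\<bar>f x\<bar> powr p) + ennreal (\<bar>g x\<bar> powr p)) \<partial>lborel)"
    unfolding lpow_def
  proof (rule nn_integral_mono)
    fix x
    have "ennreal (\<bar>f x + g x\<bar> powr p) \<le> ennreal (4 * (\<bar>f x\<bar> powr p + \<bar>g x\<bar> powr p))"
      using abs_add_powr_le[OF p] by (intro ennreal_leI)
    thus "ennreal (\<bar>f x + g x\<bar> powr p) \<le> 4 * (ennreal (\<bar>f x\<bar> powr p) + ennreal (\<bar>g x\<bar> powr p))"
      by (simp add: ennreal_mult)
  qed
  also have "\<dots> = 4 * (lpow p f + lpow p g)"
    unfolding lpow_def by (subst nn_integral_cmult, simp, subst nn_integral_add) auto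
  finally show ?thesis .
qed

lemma lpow_cmult:
  assumes [measurable]: "f \<in> borel_measurable borel"
  shows "lpow p (\<lambda>x. c * f x) = ennreal (\<bar>c\<bar> powr p) * lpow p f"
  unfolding lpow_def
  by (subst nn_integral_cmult[symmetric]) (auto simp: abs_mult powr_mult ennreal_mult)

lemma lpow_indicator_le: "lpow p (\<lambda>x. f x * indicator A x) \<le> lpow p f"
  unfolding lpow_def by (intro nn_integral_mono) (auto simp: indicator_def)

context prob_space begin

lemma prob_gt_le_add:
  assumes [measurable]: "Y \<in> borel_measurable M" "U \<in> borel_measurable M" "V \<in> borel_measurable M"
    and "AE \<omega> in M. \<bar>Y \<omega>\<bar> \<le> \<bar>U \<omega>\<bar> + \<bar>V \<omega>\<bar>" "u + v \<le> y"
  shows "prob {\<omega>\<in>space M. y < \<bar>Y \<omega>\<bar>} \<le> prob {\<omega>\<in>space M. u < \<bar>U \<omega>\<bar>} + prob {\<omega>\<in>space M. v < \<bar>V \<omega> :: real\<bar>}"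
proof -
  have "prob {\<omega>\<in>space M. y < \<bar>Y \<omega>\<bar>} \<le> prob ({\<omega>\<in>space M. u < \<bar>U \<omega>\<bar>} \<union> {\<omega>\<in>space M. v < \<bar>V \<omega>\<bar>})"
  proof (rule finite_measure_mono_AE)
    show "AE \<omega> in M. \<omega> \<in> {\<omega>\<in>space M. y < \<bar>Y \<omega>\<bar>} \<longrightarrow> \<omega> \<in> {\<omega>\<in>space M. u < \<bar>U \<omega>\<bar>} \<union> {\<omega>\<in>space M. v < \<bar>V \<omega>\<bar>}"
      using assms(4) by eventually_elim (use assms(5) in auto)
  qed measurable
  also have "\<dots> \<le> prob {\<omega>\<in>space M. u < \<bar>U \<omega>\<bar>} + prob {\<omega>\<in>space M. v < \<bar>V \<omega>\<bar>}"
    by (intro measure_Un_le) auto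
  finally show ?thesis .
qed

lemma tendsto_prob_gt:
  fixes Y :: "nat \<Rightarrow> 'a \<Rightarrow> real"
  assumes [measurable]: "\<And>n. Y n \<in> borel_measurable M" "V \<in> borel_measurable M"
    and lim: "\<And>\<omega>. \<omega> \<in> space M \<Longrightarrow> (\<lambda>n. Y n \<omega>) \<longlonglongrightarrow> V \<omega>" and "0 < \<delta>"
  shows "(\<lambda>n. prob {\<omega>\<in>space M. \<delta> < \<bar>V \<omega> - Y n \<omega>\<bar>}) \<longlonglongrightarrow> 0"
proof -
  let ?i = "\<lambda>n. indicator {\<omega>\<in>space M. \<delta> < \<bar>V \<omega> - Y n \<omega>\<bar>} :: 'a \<Rightarrow> real"
  have "(\<lambda>n. expectation (?i n)) \<longlonglongrightarrow> expectation (\<lambda>_. 0)"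
  proof (rule integral_dominated_convergence[where w = "\<lambda>_. 1"])
    show "AE \<omega> in M. (\<lambda>n. ?i n \<omega>) \<longlonglongrightarrow> 0"
    proof (rule AE_I2)
      fix \<omega> assume \<omega>: "\<omega> \<in> space M"
      have "eventually (\<lambda>n. \<bar>V \<omega> - Y n \<omega>\<bar> < \<delta>) sequentially"
        using tendstoD[OF lim[OF \<omega>] \<open>0 < \<delta>\<close>] by (simp add: dist_real_def abs_minus_commute)
      hence "eventually (\<lambda>n. ?i n \<omega> = 0) sequentially" by eventually_elim auto
      thus "(\<lambda>n. ?i n \<omega>) \<longlonglongrightarrow> 0" by (rule tendsto_eventually)
    qed
  qed (auto simp: indicator_def)
  thus ?thesis by simp
qed

end

context sas_random_measure begin

text \<open>
  The \<open>\<delta>\<close>-formulation of \<^const>\<open>has_stable_integral\<close>: it passes to limits without a diagonal argument.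
\<close>

definition stable_approx :: "(real \<Rightarrow> real) \<Rightarrow> ('a \<Rightarrow> real) \<Rightarrow> bool"
  where "stable_approx f Y \<longleftrightarrow> f \<in> borel_measurable borel \<and> Y \<in> borel_measurable M \<and>
    (\<forall>\<delta>>0. \<exists>s. simple_finite s \<and> lpow \<alpha> (\<lambda>x. s x - f x) < ennreal \<delta> \<and>
       prob {\<omega>\<in>space M. \<delta> < \<bar>Y \<omega> - I s \<omega>\<bar>} < \<delta>)"

lemma stable_approxD:
  assumes "stable_approx f Y"
  shows "f \<in> borel_measurable borel" "Y \<in> borel_measurable M"
  using assms by (auto simp: stable_approx_def)

lemma stable_approx_ex:
  assumes "stable_approx f Y" "0 < \<delta>"
  shows "\<exists>s. simple_finite s \<and> lpow \<alpha> (\<lambda>x. s x - f x) < ennreal \<delta> \<and>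
       prob {\<omega>\<in>space M. \<delta> < \<bar>Y \<omega> - I s \<omega>\<bar>} < \<delta>"
  using assms by (simp add: stable_approx_def)

lemma stable_approx_has_stable_integral:
  assumes "has_stable_integral M \<alpha> Z f Y"
  shows "stable_approx f Y"
proof -
  from assms obtain s where [measurable]: "f \<in> borel_measurable borel" "Y \<in> borel_measurable M"
    and s: "\<And>n. simple_finite (s n)" and l: "(\<lambda>n. lpow \<alpha> (\<lambda>x. s n x - f x)) \<longlonglongrightarrow> 0"
    and p: "tendsto_in_prob M (\<lambda>n. I (s n)) Y"
    unfolding has_stable_integral_def simple_finite_def lpow_def by auto
  have "\<exists>s. simple_finite s \<and> lpow \<alpha> (\<lambda>x. s x - f x) < ennreal \<delta> \<and> prob {\<omega>\<in>space M. \<delta> < \<bar>Y \<omega> - I s \<omega>\<bar>} < \<delta>"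
    if "0 < \<delta>" for \<delta>
  proof -
    have "eventually (\<lambda>n. lpow \<alpha> (\<lambda>x. s n x - f x) < ennreal \<delta>) sequentially"
      using that by (intro order_tendstoD(2)[OF l]) simp
    moreover have "eventually (\<lambda>n. prob {\<omega>\<in>space M. \<delta> < \<bar>I (s n) \<omega> - Y \<omega>\<bar>} < \<delta>) sequentially"
      using p that unfolding tendsto_in_prob_def by (intro order_tendstoD(2)[where y = 0]) auto
    ultimately have "eventually (\<lambda>n. lpow \<alpha> (\<lambda>x. s n x - f x) < ennreal \<delta> \<and>
        prob {\<omega>\<in>space M. \<delta> < \<bar>Y \<omega> - I (s n) \<omega>\<bar>} < \<delta>) sequentially"
      by eventually_elim (simp add: abs_minus_commute)
    from eventually_happens'[OF sequentially_bot this] show ?thesis using s by blast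
  qed
  thus ?thesis by (auto simp: stable_approx_def)
qed

end

text \<open>Strict inequality \<open>\<alpha> < 2\<close> makes \<open>4 - 2 powr \<alpha>\<close>
  positive. For \<open>\<alpha> = 2\<close> the measure is Gaussian and a lower tail bound of power
  type is false.\<close>

locale sas_random_measure_lt2 = sas_random_measure +
  assumes alpha: "0 < \<alpha>" "\<alpha> < 2"
begin

lemma stable_approx_0: "stable_approx (\<lambda>_. 0) (\<lambda>_. 0)"
proof -
  have "I (\<lambda>_. 0) = (\<lambda>_. 0)" using I_cmult[of 0 "\<lambda>_. 0"] by auto
  thus ?thesis unfolding stable_approx_def using simple_finite_0
    by (auto intro!: exI[of _ "\<lambda>_. 0"] simp: lpow_def)
qed

lemma stable_approx_add:
  assumes f: "stable_approx f Y" and g: "stable_approx g V"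
  shows "stable_approx (\<lambda>x. f x + g x) (\<lambda>\<omega>. Y \<omega> + V \<omega>)"
proof -
  note [measurable] = stable_approxD(1,2)[OF f] stable_approxD(1,2)[OF g]
  have "\<exists>s. simple_finite s \<and> lpow \<alpha> (\<lambda>x. s x - (f x + g x)) < ennreal \<delta> \<and>
     prob {\<omega>\<in>space M. \<delta> < \<bar>Y \<omega> + V \<omega> - I s \<omega>\<bar>} < \<delta>" if "0 < \<delta>" for \<delta>
  proof -
    \<comment> \<open>Two errors of \<open>\<delta>/8\<close>, multiplied by the constant 4 of
      \<open>lpow_add_le\<close>, give exactly \<open>\<delta>\<close>; the two probabilities only
      need a sum below \<open>\<delta>\<close>.\<close>
    have d8: "0 < \<delta>/8" using that by simp
    obtain s where s: "simple_finite s" "lpow \<alpha> (\<lambda>x. s x - f x) < ennreal (\<delta>/8)"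
       "prob {\<omega>\<in>space M. \<delta>/8 < \<bar>Y \<omega> - I s \<omega>\<bar>} < \<delta>/8"
      using stable_approx_ex[OF f d8] by blast
    obtain t where t: "simple_finite t" "lpow \<alpha> (\<lambda>x. t x - g x) < ennreal (\<delta>/8)"
       "prob {\<omega>\<in>space M. \<delta>/8 < \<bar>V \<omega> - I t \<omega>\<bar>} < \<delta>/8"
      using stable_approx_ex[OF g d8] by blast
    note [measurable] = simple_finiteD(3)[OF s(1)] simple_finiteD(3)[OF t(1)] I_measurable[OF s(1)] I_measurable[OF t(1)]
      I_measurable[OF simple_finite_add[OF s(1) t(1)]]
    have "lpow \<alpha> (\<lambda>x. s x + t x - (f x + g x)) = lpow \<alpha> (\<lambda>x. (s x - f x) + (t x - g x))"
      by (simp add: algebra_simps)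
    also have "\<dots> \<le> 4 * (lpow \<alpha> (\<lambda>x. s x - f x) + lpow \<alpha> (\<lambda>x. t x - g x))"
      using alpha by (intro lpow_add_le) auto
    also have "\<dots> < 4 * (ennreal (\<delta>/8) + ennreal (\<delta>/8))"
      by (intro ennreal_mult_strict_left_mono add_strict_mono s t) auto
    also have "\<dots> = ennreal \<delta>" using that by (simp add: ennreal_plus[symmetric] ennreal_numeral[symmetric] ennreal_mult[symmetric] del: ennreal_plus ennreal_numeral)
    finally have "lpow \<alpha> (\<lambda>x. s x + t x - (f x + g x)) < ennreal \<delta>" .
    moreover have "prob {\<omega>\<in>space M. \<delta> < \<bar>Y \<omega> + V \<omega> - I (\<lambda>x. s x + t x) \<omega>\<bar>}
      \<le> prob {\<omega>\<in>space M. \<delta>/8 < \<bar>Y \<omega> - I s \<omega>\<bar>} + prob {\<omega>\<in>space M. \<delta>/8 < \<bar>V \<omega> - I t \<omega>\<bar>}"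
    proof (rule prob_gt_le_add)
      show "AE \<omega> in M. \<bar>Y \<omega> + V \<omega> - I (\<lambda>x. s x + t x) \<omega>\<bar> \<le> \<bar>Y \<omega> - I s \<omega>\<bar> + \<bar>V \<omega> - I t \<omega>\<bar>"
        using AE_I_add[OF s(1) t(1)] by eventually_elim auto
    qed (use that in auto)
    ultimately show ?thesis using simple_finite_add[OF s(1) t(1)] s t that
      by (intro exI[of _ "\<lambda>x. s x + t x"]) auto
  qed
  thus ?thesis by (auto simp: stable_approx_def)
qed

lemma stable_approx_cmult:
  assumes f: "stable_approx f Y"
  shows "stable_approx (\<lambda>x. c * f x) (\<lambda>\<omega>. c * Y \<omega>)"
proof -
  note [measurable] = stable_approxD(1,2)[OF f]
  have "\<exists>s. simple_finite s \<and> lpow \<alpha> (\<lambda>x. s x - c * f x) < ennreal \<delta> \<and>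
     prob {\<omega>\<in>space M. \<delta> < \<bar>c * Y \<omega> - I s \<omega>\<bar>} < \<delta>" if "0 < \<delta>" for \<delta>
  proof -
    define \<epsilon> where "\<epsilon> = \<delta> / (1 + \<bar>c\<bar> powr \<alpha> + \<bar>c\<bar>)"
    have pos: "1 + \<bar>c\<bar> powr \<alpha> + \<bar>c\<bar> > 0" by (auto intro!: add_pos_nonneg)
    have \<epsilon>: "\<epsilon> > 0" "\<epsilon> \<le> \<delta>" "\<bar>c\<bar> powr \<alpha> * \<epsilon> < \<delta>" "\<bar>c\<bar> * \<epsilon> \<le> \<delta>"
      using that pos by (auto simp: \<epsilon>_def field_simps add_pos_nonneg)
    obtain s where s: "simple_finite s" "lpow \<alpha> (\<lambda>x. s x - f x) < ennreal \<epsilon>"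
       "prob {\<omega>\<in>space M. \<epsilon> < \<bar>Y \<omega> - I s \<omega>\<bar>} < \<epsilon>"
      using stable_approx_ex[OF f \<epsilon>(1)] by blast
    note [measurable] = simple_finiteD(3)[OF s(1)] I_measurable[OF s(1)]
    have "lpow \<alpha> (\<lambda>x. c * s x - c * f x) = ennreal (\<bar>c\<bar> powr \<alpha>) * lpow \<alpha> (\<lambda>x. s x - f x)"
      by (subst lpow_cmult[symmetric]) (auto simp: algebra_simps)
    also have "\<dots> \<le> ennreal (\<bar>c\<bar> powr \<alpha>) * ennreal \<epsilon>" using s by (intro mult_left_mono) auto
    also have "\<dots> < ennreal \<delta>" using \<epsilon> that by (simp add: ennreal_mult[symmetric] ennreal_lessI)
    finally have "lpow \<alpha> (\<lambda>x. c * s x - c * f x) < ennreal \<delta>" .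
    moreover have "prob {\<omega>\<in>space M. \<delta> < \<bar>c * Y \<omega> - I (\<lambda>x. c * s x) \<omega>\<bar>} \<le> prob {\<omega>\<in>space M. \<epsilon> < \<bar>Y \<omega> - I s \<omega>\<bar>}"
    proof (intro finite_measure_mono subsetI)
      fix \<omega> assume \<omega>: "\<omega> \<in> {\<omega>\<in>space M. \<delta> < \<bar>c * Y \<omega> - I (\<lambda>x. c * s x) \<omega>\<bar>}"
      hence "\<bar>c\<bar> * \<epsilon> < \<bar>c\<bar> * \<bar>Y \<omega> - I s \<omega>\<bar>"
        using \<epsilon>(4) by (simp add: I_cmult abs_mult[symmetric] right_diff_distrib)
      thus "\<omega> \<in> {\<omega>\<in>space M. \<epsilon> < \<bar>Y \<omega> - I s \<omega>\<bar>}" using \<omega> by (auto simp: mult_less_cancel_left)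
    qed auto
    ultimately show ?thesis using simple_finite_cmult[OF s(1)] s(3) \<epsilon>
      by (intro exI[of _ "\<lambda>x. c * s x"]) auto
  qed
  thus ?thesis by (auto simp: stable_approx_def)
qed

lemma stable_approx_sum:
  assumes "finite J" "\<And>i. i \<in> J \<Longrightarrow> stable_approx (f i) (Y i)"
  shows "stable_approx (\<lambda>x. \<Sum>i\<in>J. c i * f i x) (\<lambda>\<omega>. \<Sum>i\<in>J. c i * Y i \<omega>)"
  using assms
  by (induction J rule: finite_induct) (auto intro!: stable_approx_0 stable_approx_add stable_approx_cmult)

text \<open>Replaces a stochastic Fubini theorem: if Riemann sums of kernels converge in
  \<open>L^\<alpha>\<close> and the same sums of paths converge pointwise, the pathwise integral is
  a stable integral. An approximant of one late \<open>f n\<close> is already an approximant of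
  \<open>g\<close>.\<close>

lemma stable_approx_limit:
  assumes f: "\<And>n. stable_approx (f n) (Y n)"
    and [measurable]: "g \<in> borel_measurable borel" "V \<in> borel_measurable M"
    and l: "(\<lambda>n. lpow \<alpha> (\<lambda>x. f n x - g x)) \<longlonglongrightarrow> 0"
    and lim: "\<And>\<omega>. \<omega> \<in> space M \<Longrightarrow> (\<lambda>n. Y n \<omega>) \<longlonglongrightarrow> V \<omega>"
  shows "stable_approx g V"
proof -
  note [measurable] = stable_approxD(1,2)[OF f]
  have "\<exists>s. simple_finite s \<and> lpow \<alpha> (\<lambda>x. s x - g x) < ennreal \<delta> \<and>
     prob {\<omega>\<in>space M. \<delta> < \<bar>V \<omega> - I s \<omega>\<bar>} < \<delta>" if "0 < \<delta>" for \<delta>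
  proof -
    have d8: "0 < \<delta>/8" using that by simp
    have "eventually (\<lambda>n. lpow \<alpha> (\<lambda>x. f n x - g x) < ennreal (\<delta>/8)) sequentially"
      using that by (intro order_tendstoD(2)[OF l]) simp
    moreover have "eventually (\<lambda>n. prob {\<omega>\<in>space M. \<delta>/8 < \<bar>V \<omega> - Y n \<omega>\<bar>} < \<delta>/8) sequentially"
      using that lim by (intro order_tendstoD(2)[OF tendsto_prob_gt]) auto
    ultimately have "eventually (\<lambda>n. lpow \<alpha> (\<lambda>x. f n x - g x) < ennreal (\<delta>/8) \<and>
        prob {\<omega>\<in>space M. \<delta>/8 < \<bar>V \<omega> - Y n \<omega>\<bar>} < \<delta>/8) sequentially"
      by eventually_elim simp
    from eventually_happens'[OF sequentially_bot this]
    obtain n where n: "lpow \<alpha> (\<lambda>x. f n x - g x) < ennreal (\<delta>/8)" "prob {\<omega>\<in>space M. \<delta>/8 < \<bar>V \<omega> - Y n \<omega>\<bar>} < \<delta>/8"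
      by blast
    obtain s where s: "simple_finite s" "lpow \<alpha> (\<lambda>x. s x - f n x) < ennreal (\<delta>/8)"
       "prob {\<omega>\<in>space M. \<delta>/8 < \<bar>Y n \<omega> - I s \<omega>\<bar>} < \<delta>/8"
      using stable_approx_ex[OF f[of n] d8] by blast
    note [measurable] = simple_finiteD(3)[OF s(1)] I_measurable[OF s(1)]
    have "lpow \<alpha> (\<lambda>x. s x - g x) = lpow \<alpha> (\<lambda>x. (s x - f n x) + (f n x - g x))"
      by (simp add: algebra_simps)
    also have "\<dots> \<le> 4 * (lpow \<alpha> (\<lambda>x. s x - f n x) + lpow \<alpha> (\<lambda>x. f n x - g x))"
      using alpha by (intro lpow_add_le) auto
    also have "\<dots> < 4 * (ennreal (\<delta>/8) + ennreal (\<delta>/8))"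
      by (intro ennreal_mult_strict_left_mono add_strict_mono s n) auto
    also have "\<dots> = ennreal \<delta>" using that by (simp add: ennreal_plus[symmetric] ennreal_numeral[symmetric] ennreal_mult[symmetric] del: ennreal_plus ennreal_numeral)
    finally have "lpow \<alpha> (\<lambda>x. s x - g x) < ennreal \<delta>" .
    moreover have "prob {\<omega>\<in>space M. \<delta> < \<bar>V \<omega> - I s \<omega>\<bar>}
      \<le> prob {\<omega>\<in>space M. \<delta>/8 < \<bar>Y n \<omega> - I s \<omega>\<bar>} + prob {\<omega>\<in>space M. \<delta>/8 < \<bar>V \<omega> - Y n \<omega>\<bar>}"
      by (rule prob_gt_le_add) (use that in auto)
    ultimately show ?thesis using s n that by (intro exI[of _ s]) auto
  qed
  thus ?thesis by (auto simp: stable_approx_def)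
qed

text \<open>The tail bound for an approximating simple function, with error \<open>\<delta>\<close>
  sent to 0. The constant is \<open>8 * 4 * 4\<close>: the bound for simple functions, the
  quasi-triangle inequality, and \<open>(r / 2) powr \<alpha> \<ge> r powr \<alpha> / 4\<close>
  after halving the threshold.\<close>

lemma stable_approx_tail:
  assumes f: "stable_approx f Y" and B: "lpow \<alpha> f \<le> ennreal B" "0 \<le> B" and r: "0 < r"
  shows "prob {\<omega>\<in>space M. r < \<bar>Y \<omega>\<bar>} \<le> 128 * B / r powr \<alpha>"
proof -
  note [measurable] = stable_approxD(1,2)[OF f]
  have le: "prob {\<omega>\<in>space M. r < \<bar>Y \<omega>\<bar>} \<le> 128 * (B + \<delta>) / r powr \<alpha> + \<delta>" if \<delta>: "0 < \<delta>" "\<delta> \<le> r / 2" for \<delta>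
  proof -
    obtain s where s: "simple_finite s" "lpow \<alpha> (\<lambda>x. s x - f x) < ennreal \<delta>"
       "prob {\<omega>\<in>space M. \<delta> < \<bar>Y \<omega> - I s \<omega>\<bar>} < \<delta>"
      using stable_approx_ex[OF f \<delta>(1)] by blast
    note [measurable] = simple_finiteD(3)[OF s(1)] I_measurable[OF s(1)]
    have "lpow \<alpha> s = lpow \<alpha> (\<lambda>x. (s x - f x) + f x)" by simp
    also have "\<dots> \<le> 4 * (lpow \<alpha> (\<lambda>x. s x - f x) + lpow \<alpha> f)"
      using alpha by (intro lpow_add_le) auto
    also have "\<dots> \<le> 4 * (ennreal \<delta> + ennreal B)"
      using s B by (intro mult_left_mono add_mono) auto
    also have "\<dots> = ennreal (4 * (B + \<delta>))" using \<delta> B by (simp add: ennreal_plus[symmetric] ennreal_numeral[symmetric] ennreal_mult[symmetric] algebra_simps del: ennreal_plus ennreal_numeral)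
    finally have S: "enn2real (lpow \<alpha> s) \<le> 4 * (B + \<delta>)" using \<delta> B by (simp add: enn2real_leI)
    have "prob {\<omega>\<in>space M. r < \<bar>Y \<omega>\<bar>} \<le> prob {\<omega>\<in>space M. r / 2 < \<bar>I s \<omega>\<bar>} + prob {\<omega>\<in>space M. \<delta> < \<bar>Y \<omega> - I s \<omega>\<bar>}"
      by (rule prob_gt_le_add) (use \<delta> in auto)
    also have "prob {\<omega>\<in>space M. r / 2 < \<bar>I s \<omega>\<bar>} \<le> 8 * enn2real (lpow \<alpha> s) / (r / 2) powr \<alpha>"
      using alpha r by (intro stable_tail_upper char_I s) auto
    also have "\<dots> \<le> 8 * (4 * (B + \<delta>)) / (r powr \<alpha> / 4)"
    proof (intro frac_le)
      have "r powr \<alpha> / 4 \<le> r powr \<alpha> / 2 powr \<alpha>"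
        using alpha powr_mono[of \<alpha> 2 2] by (intro divide_left_mono) auto
      thus "r powr \<alpha> / 4 \<le> (r / 2) powr \<alpha>" using r by (simp add: powr_divide)
    qed (use \<delta> B S r in auto)
    also have "\<dots> = 128 * (B + \<delta>) / r powr \<alpha>" by simp
    finally show ?thesis using s(3) by linarith
  qed
  show ?thesis
  proof (rule tendsto_lowerbound)
    show "((\<lambda>\<delta>. 128 * (B + \<delta>) / r powr \<alpha> + \<delta>) \<longlongrightarrow> 128 * B / r powr \<alpha>) (at_right 0)"
      using r by (auto intro!: tendsto_eq_intros)
    show "eventually (\<lambda>\<delta>. prob {\<omega>\<in>space M. r < \<bar>Y \<omega>\<bar>} \<le> 128 * (B + \<delta>) / r powr \<alpha> + \<delta>) (at_right 0)"
      using r by (intro eventually_at_rightI[of 0 "r/2"] le) auto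
  qed auto
qed

text \<open>The constant of \<open>stable_tail_lower\<close> evaluated with \<open>a / 8\<close> for
  \<open>a\<close> and \<open>3 * r\<close> for \<open>r\<close>, the values to which approximation
  and truncation reduce the data in the next lemma.\<close>

definition tail_const :: real where
  "tail_const = (4 - 2 powr \<alpha>) / 32 * ((4 - 2 powr \<alpha>) / 4) powr (\<alpha> / 2) / (8 * 3 powr \<alpha>)"

lemma tail_const_pos: "0 < tail_const"
  using alpha powr_less_mono[of \<alpha> 2 2] by (auto simp: tail_const_def)

text \<open>
  The parts of the integrals over the disjoint sets \<open>A k\<close> are independent, and the remainders are small.
  Both parts are only formed for approximating simple functions, so that no integral of \<open>f k * indicator (A k)\<close>
  has to be constructed.
\<close>

lemma stable_approx_all_small:
  fixes f :: "'k \<Rightarrow> real \<Rightarrow> real"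
  assumes K: "finite K" "K \<noteq> {}" and f: "\<And>k. k \<in> K \<Longrightarrow> stable_approx (f k) (Y k)"
    and A: "\<And>k. k \<in> K \<Longrightarrow> A k \<in> sets borel" and disj: "disjoint_family_on A K"
    and a: "\<And>k. k \<in> K \<Longrightarrow> ennreal a \<le> lpow \<alpha> (\<lambda>x. f k x * indicator (A k) x)" "0 < a"
    and b: "\<And>k. k \<in> K \<Longrightarrow> lpow \<alpha> (\<lambda>x. f k x * indicator (- A k) x) \<le> ennreal b" "0 \<le> b"
    and r: "0 < r" "a / r powr \<alpha> \<le> 4 - 2 powr \<alpha>"
  shows "prob {\<omega>\<in>space M. \<forall>k\<in>K. \<bar>Y k \<omega>\<bar> \<le> r}
     \<le> exp (- (tail_const * (a / r powr \<alpha>)) * card K) + card K * (32 * b / r powr \<alpha>)"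
proof -
  note meas = stable_approxD(1,2)[OF f]
  define p where "p = tail_const * (a / r powr \<alpha>)"
  have \<tau>: "0 < 4 - 2 powr \<alpha>" using alpha powr_less_mono[of \<alpha> 2 2] by auto
  have le: "prob {\<omega>\<in>space M. \<forall>k\<in>K. \<bar>Y k \<omega>\<bar> \<le> r} \<le> exp (- p * card K) + card K * (32 * (b + \<delta>) / r powr \<alpha> + \<delta>)"
    if \<delta>: "0 < \<delta>" "\<delta> \<le> r" "\<delta> \<le> a / 8" for \<delta>
  proof -
    have "\<forall>k\<in>K. \<exists>s. simple_finite s \<and> lpow \<alpha> (\<lambda>x. s x - f k x) < ennreal \<delta> \<and>
       prob {\<omega>\<in>space M. \<delta> < \<bar>Y k \<omega> - I s \<omega>\<bar>} < \<delta>"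
      using stable_approx_ex[OF f \<delta>(1)] by blast
    then obtain s where s: "\<And>k. k \<in> K \<Longrightarrow> simple_finite (s k)"
      "\<And>k. k \<in> K \<Longrightarrow> lpow \<alpha> (\<lambda>x. s k x - f k x) < ennreal \<delta>"
      "\<And>k. k \<in> K \<Longrightarrow> prob {\<omega>\<in>space M. \<delta> < \<bar>Y k \<omega> - I (s k) \<omega>\<bar>} < \<delta>"
      by (subst (asm) bchoice_iff) blast
    define u where "u k x = s k x * indicator (A k) x" for k x
    define v where "v k x = s k x * indicator (- A k) x" for k x
    have u: "simple_finite (u k)" if "k \<in> K" for k
      unfolding u_def by (intro simple_finite_indicator s that A)
    have v: "simple_finite (v k)" if "k \<in> K" for k
      unfolding v_def using A[OF that] by (intro simple_finite_indicator s that) auto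
    note meas2 = simple_finiteD(3)[OF s(1)] I_measurable[OF s(1)] I_measurable[OF u] I_measurable[OF v]
    have uv: "(\<lambda>x. u k x + v k x) = s k" for k by (auto simp: u_def v_def indicator_def)
    have restr: "lpow \<alpha> (\<lambda>x. (s k x - f k x) * indicator B x) \<le> ennreal \<delta>" if "k \<in> K" for k B
      using lpow_indicator_le s(2)[OF that] by (meson order.trans less_imp_le)
    \<comment> \<open>If \<open>\<bar>Y k\<bar> \<le> r\<close>, the approximation error is at most
      \<open>\<delta> \<le> r\<close> and the remainder part is at most \<open>r\<close>, then the
      main part is at most \<open>3 * r\<close>. The main parts are supported in the disjoint sets
      \<open>A k\<close>, so \<open>?E1\<close> is an intersection of independent events.\<close>
    let ?E1 = "{\<omega>\<in>space M. \<forall>k\<in>K. \<bar>I (u k) \<omega>\<bar> \<le> 3 * r}"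
    let ?E2 = "\<Union>k\<in>K. {\<omega>\<in>space M. r < \<bar>I (v k) \<omega>\<bar>}"
    let ?E3 = "\<Union>k\<in>K. {\<omega>\<in>space M. \<delta> < \<bar>Y k \<omega> - I (s k) \<omega>\<bar>}"
    have m1: "?E1 \<in> events"
      using K meas2 by measurable
    have m2: "{\<omega>\<in>space M. r < \<bar>I (v k) \<omega>\<bar>} \<in> events" if "k \<in> K" for k
      using meas2(4)[OF that] by measurable
    have m3: "{\<omega>\<in>space M. \<delta> < \<bar>Y k \<omega> - I (s k) \<omega>\<bar>} \<in> events" if "k \<in> K" for k
      using meas2(2)[OF that] meas(2)[OF that] by measurable
    have m23: "?E2 \<in> events" "?E3 \<in> events" using K m2 m3 by auto
    have "prob {\<omega>\<in>space M. \<forall>k\<in>K. \<bar>Y k \<omega>\<bar> \<le> r} \<le> prob (?E1 \<union> (?E2 \<union> ?E3))"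
    proof (rule finite_measure_mono_AE)
      have "AE \<omega> in M. \<forall>k\<in>K. I (\<lambda>x. u k x + v k x) \<omega> = I (u k) \<omega> + I (v k) \<omega>"
        using u v K by (intro AE_finite_allI AE_I_add) auto
      thus "AE \<omega> in M. \<omega> \<in> {\<omega>\<in>space M. \<forall>k\<in>K. \<bar>Y k \<omega>\<bar> \<le> r} \<longrightarrow> \<omega> \<in> ?E1 \<union> (?E2 \<union> ?E3)"
      proof eventually_elim
        case (elim \<omega>)
        show ?case
        proof (intro impI)
          assume \<omega>: "\<omega> \<in> {\<omega>\<in>space M. \<forall>k\<in>K. \<bar>Y k \<omega>\<bar> \<le> r}"
          show "\<omega> \<in> ?E1 \<union> (?E2 \<union> ?E3)"
          proof (rule ccontr)
            assume n: "\<omega> \<notin> ?E1 \<union> (?E2 \<union> ?E3)"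
            then obtain k where k: "k \<in> K" "3 * r < \<bar>I (u k) \<omega>\<bar>" using \<omega> by force
            moreover have "\<bar>I (v k) \<omega>\<bar> \<le> r" "\<bar>Y k \<omega> - I (s k) \<omega>\<bar> \<le> \<delta>" "\<bar>Y k \<omega>\<bar> \<le> r" using n k \<omega> by force+
            moreover have "I (s k) \<omega> = I (u k) \<omega> + I (v k) \<omega>" using elim k by (simp add: uv)
            ultimately show False using \<delta> by linarith
          qed
        qed
      qed
    qed (use m1 m23 in auto)
    also have "\<dots> \<le> prob ?E1 + (prob ?E2 + prob ?E3)"
      using m1 m23 by (intro order_trans[OF measure_Un_le] add_mono order_refl) auto
    also have "prob ?E3 \<le> (\<Sum>k\<in>K. prob {\<omega>\<in>space M. \<delta> < \<bar>Y k \<omega> - I (s k) \<omega>\<bar>})"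
      using K m3 by (intro measure_UNION_le) auto
    also have "\<dots> \<le> card K * \<delta>" using s(3) by (intro sum_bounded_above) (auto intro: less_imp_le)
    also have "prob ?E2 \<le> (\<Sum>k\<in>K. prob {\<omega>\<in>space M. r < \<bar>I (v k) \<omega>\<bar>})"
      using K m2 by (intro measure_UNION_le) auto
    also have "\<dots> \<le> card K * (32 * (b + \<delta>) / r powr \<alpha>)"
    proof (intro sum_bounded_above)
      fix k assume k: "k \<in> K"
      note [measurable] = meas[OF k] meas2[OF k] A[OF k]
      have vk: "v k = (\<lambda>x. s k x * indicator (- A k) x)" by (rule ext) (simp add: v_def)
      have "lpow \<alpha> (v k) = lpow \<alpha> (\<lambda>x. (s k x - f k x) * indicator (- A k) x + f k x * indicator (- A k) x)"
        by (simp add: vk algebra_simps)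
      also have "\<dots> \<le> 4 * (lpow \<alpha> (\<lambda>x. (s k x - f k x) * indicator (- A k) x) + lpow \<alpha> (\<lambda>x. f k x * indicator (- A k) x))"
        using alpha by (intro lpow_add_le) auto
      also have "\<dots> \<le> 4 * (ennreal \<delta> + ennreal b)"
        by (intro mult_left_mono add_mono restr b k) auto
      also have "\<dots> = ennreal (4 * (b + \<delta>))" using \<delta> b(2) by (simp add: ennreal_plus[symmetric] ennreal_numeral[symmetric] ennreal_mult[symmetric] algebra_simps del: ennreal_plus ennreal_numeral)
      finally have S: "enn2real (lpow \<alpha> (v k)) \<le> 4 * (b + \<delta>)" using \<delta> b(2) by (simp add: enn2real_leI)
      have "prob {\<omega>\<in>space M. r < \<bar>I (v k) \<omega>\<bar>} \<le> 8 * enn2real (lpow \<alpha> (v k)) / r powr \<alpha>"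
        using alpha r by (intro stable_tail_upper char_I v k) auto
      also have "\<dots> \<le> 8 * (4 * (b + \<delta>)) / r powr \<alpha>"
        using S r by (intro divide_right_mono) auto
      finally show "prob {\<omega>\<in>space M. r < \<bar>I (v k) \<omega>\<bar>} \<le> 32 * (b + \<delta>) / r powr \<alpha>" by simp
    qed
    also have "prob ?E1 \<le> exp (- p * card K)"
    proof -
      have "indep_vars (\<lambda>_. borel) (\<lambda>k. I (u k)) K"
        using disj by (intro indep_I K u) (auto simp: disjoint_family_on_def u_def indicator_def)
      hence "prob (\<Inter>k\<in>K. I (u k) -` {x. \<bar>x\<bar> \<le> 3 * r} \<inter> space M) = (\<Prod>k\<in>K. prob (I (u k) -` {x. \<bar>x\<bar> \<le> 3 * r} \<inter> space M))"
        using K by (intro indep_varsD_finite) auto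
      also have "(\<Inter>k\<in>K. I (u k) -` {x. \<bar>x\<bar> \<le> 3 * r} \<inter> space M) = ?E1" using K by auto
      also have "(\<Prod>k\<in>K. prob (I (u k) -` {x. \<bar>x\<bar> \<le> 3 * r} \<inter> space M)) \<le> (\<Prod>k\<in>K. exp (- p))"
      proof (intro prod_mono conjI)
        fix k assume k: "k \<in> K"
        note [measurable] = meas[OF k] meas2[OF k] A[OF k]
        have "ennreal a \<le> lpow \<alpha> (\<lambda>x. u k x + (- 1) * ((s k x - f k x) * indicator (A k) x))"
          using a(1)[OF k] by (simp add: u_def algebra_simps)
        also have "\<dots> \<le> 4 * (lpow \<alpha> (u k) + lpow \<alpha> (\<lambda>x. (- 1) * ((s k x - f k x) * indicator (A k) x)))"
          using alpha simple_finiteD(3)[OF u[OF k]] by (intro lpow_add_le) auto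
        also have "lpow \<alpha> (\<lambda>x. (- 1) * ((s k x - f k x) * indicator (A k) x)) = lpow \<alpha> (\<lambda>x. (s k x - f k x) * indicator (A k) x)"
          by (simp add: lpow_def)
        also have "4 * (lpow \<alpha> (u k) + \<dots>) \<le> 4 * (lpow \<alpha> (u k) + ennreal \<delta>)"
          by (intro mult_left_mono add_mono restr k order_refl) auto
        also have "lpow \<alpha> (u k) = ennreal (enn2real (lpow \<alpha> (u k)))" using lpow_simple[OF u[OF k]] by simp
        also have "4 * (ennreal (enn2real (lpow \<alpha> (u k))) + ennreal \<delta>) = ennreal (4 * (enn2real (lpow \<alpha> (u k)) + \<delta>))"
          using \<delta> by (simp add: ennreal_plus[symmetric] ennreal_numeral[symmetric] ennreal_mult[symmetric] del: ennreal_plus ennreal_numeral)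
        finally have "a \<le> 4 * (enn2real (lpow \<alpha> (u k)) + \<delta>)" using \<delta> by (subst (asm) ennreal_le_iff) auto
        \<comment> \<open>From \<open>a \<le> 4 * (lpow + \<delta>)\<close> follows
          \<open>lpow \<ge> a / 4 - \<delta>\<close>, and
          \<open>\<delta> \<le> a / 8\<close>.\<close>
        hence S: "a / 8 \<le> enn2real (lpow \<alpha> (u k))" using \<delta> by simp
        have "(a / 8) / (3 * r) powr \<alpha> \<le> (a / 8) / r powr \<alpha>"
          using a alpha r by (intro divide_left_mono powr_mono2) auto
        \<comment> \<open>The factor 8 lost in the scale supplies exactly the 8 in the smallness
          condition of \<open>stable_tail_lower\<close>.\<close>
        also have "\<dots> \<le> (4 - 2 powr \<alpha>) / 8" using r by simp
        finally have small: "(a / 8) / (3 * r) powr \<alpha> \<le> (4 - 2 powr \<alpha>) / 8" .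
        have "p = (4 - 2 powr \<alpha>) / 32 * ((4 - 2 powr \<alpha>) / 4) powr (\<alpha> / 2) * ((a / 8) / (3 * r) powr \<alpha>)"
          using r by (simp add: p_def tail_const_def powr_mult)
        also have "\<dots> \<le> prob {\<omega>\<in>space M. 3 * r < \<bar>I (u k) \<omega>\<bar>}"
          using alpha r a S small by (intro stable_tail_lower[where S = "enn2real (lpow \<alpha> (u k))"] char_I u k) auto
        finally have pl: "p \<le> prob {\<omega>\<in>space M. 3 * r < \<bar>I (u k) \<omega>\<bar>}" .
        have "prob (I (u k) -` {x. \<bar>x\<bar> \<le> 3 * r} \<inter> space M) = prob (space M - {\<omega>\<in>space M. 3 * r < \<bar>I (u k) \<omega>\<bar>})"
          by (rule arg_cong[where f = prob]) auto
        also have "\<dots> = 1 - prob {\<omega>\<in>space M. 3 * r < \<bar>I (u k) \<omega>\<bar>}"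
          by (rule prob_compl) measurable
        also have "\<dots> \<le> exp (- p)" using pl exp_ge_add_one_self[of "- p"] by linarith
        finally show "prob (I (u k) -` {x. \<bar>x\<bar> \<le> 3 * r} \<inter> space M) \<le> exp (- p)" .
      qed auto
      also have "\<dots> = exp (- p * card K)" by (simp add: exp_of_nat_mult[symmetric] mult.commute)
      finally show ?thesis .
    qed
    finally show ?thesis by (simp add: algebra_simps)
  qed
  show ?thesis
    unfolding p_def[symmetric]
  proof (rule tendsto_lowerbound)
    show "((\<lambda>\<delta>. exp (- p * card K) + card K * (32 * (b + \<delta>) / r powr \<alpha> + \<delta>)) \<longlongrightarrow> exp (- p * card K) + card K * (32 * b / r powr \<alpha>)) (at_right 0)"
      using r by (auto intro!: tendsto_eq_intros)
    show "eventually (\<lambda>\<delta>. prob {\<omega>\<in>space M. \<forall>k\<in>K. \<bar>Y k \<omega>\<bar> \<le> r} \<le> exp (- p * card K) + card K * (32 * (b + \<delta>) / r powr \<alpha> + \<delta>)) (at_right 0)"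
      using r a by (intro eventually_at_rightI[of 0 "min r (a/8)"] le) auto
  qed auto
qed

end

subsection \<open>Riemann sums, binomial remainder and kernel bounds\<close>

lemma floor_mult_div_LIMSEQ:
  fixes y :: real
  shows "(\<lambda>n. real_of_int \<lfloor>real n * y\<rfloor> / real n) \<longlonglongrightarrow> y"
proof (rule tendsto_sandwich)
  show "eventually (\<lambda>n. y - 1 / real n \<le> real_of_int \<lfloor>real n * y\<rfloor> / real n) sequentially"
    using eventually_gt_at_top[of 0]
  proof eventually_elim
    case (elim n)
    have "real n * y - 1 \<le> real_of_int \<lfloor>real n * y\<rfloor>" by linarith
    hence "(real n * y - 1) / real n \<le> real_of_int \<lfloor>real n * y\<rfloor> / real n" by (intro divide_right_mono) auto
    thus ?case using elim by (simp add: diff_divide_distrib)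
  qed
  show "eventually (\<lambda>n. real_of_int \<lfloor>real n * y\<rfloor> / real n \<le> y) sequentially"
    using eventually_gt_at_top[of 0]
  proof eventually_elim
    case (elim n)
    have "real_of_int \<lfloor>real n * y\<rfloor> \<le> real n * y" by linarith
    thus ?case using elim by (simp add: field_simps)
  qed
  show "(\<lambda>n. y - 1 / real n) \<longlonglongrightarrow> y"
    using tendsto_diff[OF tendsto_const lim_1_over_n, of y] by simp
qed simp

text \<open>The Riemann sum is the integral of the step function \<open>S n\<close>, which takes at
  \<open>y\<close> the value of \<open>G\<close> at the left endpoint of the cell containing
  \<open>y\<close>. Continuity gives pointwise convergence and compactness a constant majorant on
  the unit interval.\<close>

lemma riemann_sum_LIMSEQ:
  fixes G :: "real \<Rightarrow> real"
  assumes cont: "continuous_on UNIV G" and supp: "\<And>x. x \<notin> {0..1} \<Longrightarrow> G x = 0"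
  shows "(\<lambda>n. \<Sum>i<n. G (real i / real n) / real n) \<longlonglongrightarrow> (\<integral>x. G x \<partial>lborel)"
proof -
  have [measurable]: "G \<in> borel_measurable borel" using cont by (rule borel_measurable_continuous_onI)
  have "compact (G ` {0..1})" using cont continuous_on_subset by (intro compact_continuous_image) auto
  then obtain B where "\<forall>y\<in>{0..1}. \<bar>G y\<bar> \<le> B"
    by (auto dest!: compact_imp_bounded simp: bounded_iff)
  hence B: "\<bar>G y\<bar> \<le> B" if "y \<in> {0..1}" for y using that by blast
  define S where "S n y = (\<Sum>i<n. G (real i / real n) * indicator {real i / real n..<(real i + 1) / real n} y)" for n y
  have S: "S n y = (if y \<in> {0..<1} then G (real_of_int \<lfloor>real n * y\<rfloor> / real n) else 0)" if n: "0 < n" for n y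
  proof (cases "y \<in> {0..<1}")
    case True
    define k where "k = nat \<lfloor>real n * y\<rfloor>"
    have k: "real k = real_of_int \<lfloor>real n * y\<rfloor>" using True by (simp add: k_def)
    have "real n * y < real n" using True n by simp
    hence kn: "k < n" using k by linarith
    have "S n y = (\<Sum>i<n. if i = k then G (real i / real n) else 0)"
      unfolding S_def
    proof (intro sum.cong refl)
      fix i
      have "y \<in> {real i / real n..<(real i + 1) / real n} \<longleftrightarrow> real i \<le> real n * y \<and> real n * y < real i + 1"
        using n by (simp add: field_simps)
      also have "\<dots> \<longleftrightarrow> i = k" using k by linarith
      finally show "G (real i / real n) * indicator {real i / real n..<(real i + 1) / real n} y = (if i = k then G (real i / real n) else 0)"
        by (simp add: indicator_def)
    qed
    also have "\<dots> = G (real k / real n)" using kn by simp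
    finally show ?thesis using True k by simp
  next
    case False
    have "y \<notin> {real i / real n..<(real i + 1) / real n}" if "i < n" for i
    proof
      assume *: "y \<in> {real i / real n..<(real i + 1) / real n}"
      have "(real i + 1) / real n \<le> 1" using that by simp
      moreover have "0 \<le> real i / real n" by simp
      moreover have "real i / real n \<le> y" "y < (real i + 1) / real n" using * by auto
      ultimately have "0 \<le> y" "y < 1" by linarith+
      thus False using False by simp
    qed
    thus ?thesis using False by (auto simp: S_def)
  qed
  have "(\<lambda>n. \<integral>y. S n y \<partial>lborel) \<longlonglongrightarrow> (\<integral>x. G x \<partial>lborel)"
  proof (rule integral_dominated_convergence[where w = "\<lambda>y. B * indicator {0..1} y"])
    show "integrable lborel (\<lambda>y. B * indicator {0..1::real} y)" by simp
    \<comment> \<open>The half-open cells cover only \<open>{0..<1}\<close>; the endpoint 1 is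
      discarded as a null set.\<close>
    show "AE y in lborel. (\<lambda>n. S n y) \<longlonglongrightarrow> G y"
      using AE_lborel_singleton[of 1]
    proof eventually_elim
      case (elim y)
      have "(\<lambda>n. if y \<in> {0..<1} then G (real_of_int \<lfloor>real n * y\<rfloor> / real n) else 0) \<longlonglongrightarrow> G y"
      proof (cases "y \<in> {0..<1}")
        case True
        have "isCont G y" using cont by (simp add: continuous_on_eq_continuous_at)
        from isCont_tendsto_compose[OF this floor_mult_div_LIMSEQ] True show ?thesis by simp
      next
        case False
        hence "G y = 0" using elim by (intro supp) auto
        with False show ?thesis by auto
      qed
      moreover have "eventually (\<lambda>n. (if y \<in> {0..<1} then G (real_of_int \<lfloor>real n * y\<rfloor> / real n) else 0) = S n y) sequentially"
        using eventually_gt_at_top[of 0] by eventually_elim (simp add: S)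
      ultimately show ?case by (rule Lim_transform_eventually)
    qed
    show "AE y in lborel. norm (S n y) \<le> B * indicator {0..1} y" for n
    proof (rule AE_I2)
      fix y
      have B0: "0 \<le> B" using B[of 0] by auto
      show "norm (S n y) \<le> B * indicator {0..1} y"
      proof (cases "n = 0")
        case True
        thus ?thesis using B0 by (simp add: S_def)
      next
        case False
        have "real_of_int \<lfloor>real n * y\<rfloor> / real n \<in> {0..1}" if "y \<in> {0..<1}"
        proof -
          have "real n * y < real n" using that False by simp
          hence "real_of_int \<lfloor>real n * y\<rfloor> \<le> real n" by linarith
          thus ?thesis using that False by auto
        qed
        thus ?thesis using B0 False B S[of n y] by (auto simp: indicator_def)
      qed
    qed
    show "S n \<in> borel_measurable lborel" for n unfolding S_def by measurable
  qed simp
  moreover have "(\<integral>y. S n y \<partial>lborel) = (\<Sum>i<n. G (real i / real n) / real n)" for n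
  proof -
    have "(\<integral>y. S n y \<partial>lborel) = (\<Sum>i<n. \<integral>y. G (real i / real n) * indicator {real i / real n..<(real i + 1) / real n} y \<partial>lborel)"
      unfolding S_def
    proof (rule Bochner_Integration.integral_sum)
      fix i
      have "emeasure lborel {real i / real n..<(real i + 1) / real n} = ennreal ((real i + 1) / real n - real i / real n)"
        by (rule emeasure_lborel_Ico) (simp add: divide_right_mono)
      thus "integrable lborel (\<lambda>y. G (real i / real n) * indicator {real i / real n..<(real i + 1) / real n} y)"
        by (intro integrable_mult_right integrable_real_indicator) auto
    qed
    also have "\<dots> = (\<Sum>i<n. G (real i / real n) / real n)"
      by (intro sum.cong refl) (auto simp: divide_right_mono diff_divide_distrib[symmetric])
    finally show ?thesis .
  qed
  ultimately show ?thesis by simp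
qed

text \<open>Convergence of the binomial series at \<open>3/4\<close> gives absolute summability at
  the smaller point \<open>1/2\<close>. In the tail of the series, \<open>z ^ Suc n\<close> is
  factored out and the remaining powers of \<open>z\<close> are bounded by those of
  \<open>1/2\<close>, which makes \<open>C\<close> independent of \<open>z\<close>.\<close>

lemma binomial_remainder:
  fixes a :: real
  obtains C where "0 \<le> C" "\<And>z. 0 \<le> z \<Longrightarrow> z \<le> 1/2 \<Longrightarrow> \<bar>(1 + z) powr a - (\<Sum>i\<le>n. (a gchoose i) * z ^ i)\<bar> \<le> C * z ^ Suc n"
proof -
  have "summable (\<lambda>i. (a gchoose i) * (3/4) ^ i)"
    using gen_binomial_real[of "3/4" a] by (simp add: sums_iff)
  hence ab: "summable (\<lambda>i. norm ((a gchoose i) * (1/2) ^ i))"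
    by (rule powser_insidea) simp
  hence "summable (\<lambda>i. norm ((a gchoose (i + Suc n)) * (1/2) ^ (i + Suc n)))"
    by (subst summable_iff_shift)
  hence sm: "summable (\<lambda>i. 2 ^ Suc n * norm ((a gchoose (i + Suc n)) * (1/2) ^ (i + Suc n)))"
    by (rule summable_mult)
  define C where "C = (\<Sum>i. 2 ^ Suc n * norm ((a gchoose (i + Suc n)) * (1/2) ^ (i + Suc n)))"
  have C0: "0 \<le> C" unfolding C_def by (rule suminf_nonneg[OF sm]) auto
  show thesis
  proof (rule that[OF C0])
    fix z :: real assume z: "0 \<le> z" "z \<le> 1/2"
    have s: "(\<lambda>i. (a gchoose i) * z ^ i) sums (1 + z) powr a" using z by (intro gen_binomial_real) auto
    hence su: "summable (\<lambda>i. (a gchoose i) * z ^ i)" by (simp add: sums_iff)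
    have "(1 + z) powr a = (\<Sum>i. (a gchoose (i + Suc n)) * z ^ (i + Suc n)) + (\<Sum>i<Suc n. (a gchoose i) * z ^ i)"
      using suminf_split_initial_segment[OF su, of "Suc n"] s by (simp add: sums_iff)
    hence "(1 + z) powr a - (\<Sum>i\<le>n. (a gchoose i) * z ^ i) = (\<Sum>i. (a gchoose (i + Suc n)) * z ^ (i + Suc n))"
      by (simp only: lessThan_Suc_atMost add_diff_cancel_right')
    also have "norm \<dots> \<le> (\<Sum>i. 2 ^ Suc n * norm ((a gchoose (i + Suc n)) * (1/2) ^ (i + Suc n)) * z ^ Suc n)"
    proof (rule norm_suminf_le)
      fix i
      have "z ^ i \<le> (1/2) ^ i" using z by (intro power_mono) auto
      have "norm ((a gchoose (i + Suc n)) * z ^ (i + Suc n)) = \<bar>a gchoose (i + Suc n)\<bar> * (z ^ i * z ^ Suc n)"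
        using z by (simp add: abs_mult power_add)
      also have "\<dots> \<le> \<bar>a gchoose (i + Suc n)\<bar> * ((1/2) ^ i * z ^ Suc n)"
        using z \<open>z ^ i \<le> (1/2) ^ i\<close> by (intro mult_left_mono mult_right_mono) auto
      also have "\<dots> = 2 ^ Suc n * norm ((a gchoose (i + Suc n)) * (1/2) ^ (i + Suc n)) * z ^ Suc n"
        by (simp add: abs_mult power_add power_one_over)
      finally show "norm ((a gchoose (i + Suc n)) * z ^ (i + Suc n)) \<le> 2 ^ Suc n * norm ((a gchoose (i + Suc n)) * (1/2) ^ (i + Suc n)) * z ^ Suc n" .
    qed (rule summable_mult2[OF sm])
    also have "\<dots> = C * z ^ Suc n" unfolding C_def by (rule suminf_mult2[OF sm, symmetric])
    finally show "\<bar>(1 + z) powr a - (\<Sum>i\<le>n. (a gchoose i) * z ^ i)\<bar> \<le> C * z ^ Suc n" by simp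
  qed
qed

text \<open>No factor \<open>a - i\<close> vanishes, since \<open>a\<close> is not an integer. This
  keeps the leading coefficient in the asymptotics of \<open>frac_psi\<close> away from 0.\<close>

lemma gbinomial_nonzero:
  fixes a :: real
  assumes "0 < a" "a < 1"
  shows "(a gchoose n) \<noteq> 0"
proof -
  have "a - of_nat i \<noteq> 0" for i using assms by (cases i) auto
  thus ?thesis by (simp add: gbinomial_prod_rev)
qed

lemma nn_integral_powr_neg:
  fixes q :: real
  assumes "1 < q"
  shows "(\<integral>\<^sup>+s. ennreal ((- s) powr (- q)) * indicator {..-1} s \<partial>lborel) = ennreal (1 / (q - 1))"
proof -
  have "(\<integral>\<^sup>+s. ennreal ((- s) powr (- q)) * indicator {..-1} s \<partial>lborel)
      = (\<integral>\<^sup>+s. ennreal (s powr (- q)) * indicator {1..} s \<partial>lborel)"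
    by (subst nn_integral_real_affine[where c = "-1" and t = 0])
       (auto intro!: nn_integral_cong simp: indicator_def)
  also have "\<dots> = ennreal (- (1 powr (- q + 1)) / (- q + 1))"
    using assms has_integral_powr_to_inf[of "- q" 1] by (intro nn_integral_has_integral_lebesgue') auto
  also have "- (1 powr (- q + 1)) / (- q + 1) = 1 / (q - 1)" using assms by (simp add: field_simps)
  finally show ?thesis .
qed

lemma lpow_affine:
  assumes [measurable]: "f \<in> borel_measurable borel" and "0 < c"
  shows "lpow p (\<lambda>s. f (c * s + t)) = ennreal (1 / c) * lpow p f"
proof -
  have "lpow p f = ennreal c * lpow p (\<lambda>s. f (c * s + t))"
    using assms(2) unfolding lpow_def by (subst nn_integral_real_affine[where c = c and t = t]) (auto simp: add.commute)
  thus ?thesis using assms(2) by (simp add: mult.assoc[symmetric] ennreal_mult[symmetric])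
qed

text \<open>A majorant of the kernels that is uniform in \<open>t \<in> {0..1}\<close>: 2 bounds
  \<open>2 powr \<gamma>\<close> near the origin, and \<open>(- s) powr (\<gamma> - 1)\<close> is
  the size of an increment of \<open>x powr \<gamma>\<close> far to the left.\<close>

definition kernel_bound :: "real \<Rightarrow> real \<Rightarrow> real" where
  "kernel_bound \<gamma> s = (if 1 \<le> s then 0 else if - 1 \<le> s then 2 else (- s) powr (\<gamma> - 1))"

lemma kernel_bound_measurable [measurable]: "kernel_bound \<gamma> \<in> borel_measurable borel"
  unfolding kernel_bound_def by measurable

lemma kernel_bound_nonneg: "0 \<le> kernel_bound \<gamma> s"
  by (simp add: kernel_bound_def)

lemma abs_kernel_le:
  fixes s t \<gamma> :: real
  assumes \<gamma>: "0 < \<gamma>" "\<gamma> < 1" and t: "0 \<le> t" "t \<le> 1"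
  shows "\<bar>max (t - s) 0 powr \<gamma> - max (- s) 0 powr \<gamma>\<bar> \<le> kernel_bound \<gamma> s"
proof -
  have mono: "max (- s) 0 powr \<gamma> \<le> max (t - s) 0 powr \<gamma>"
    using \<gamma> t by (intro powr_mono2) auto
  consider "1 \<le> s" | "-1 \<le> s" "s < 1" | "s < -1" by linarith
  thus ?thesis
  proof cases
    case 1
    thus ?thesis using t by (simp add: kernel_bound_def)
  next
    case 2
    have "max (t - s) 0 powr \<gamma> \<le> 2 powr \<gamma>" using 2 t \<gamma> by (intro powr_mono2) auto
    also have "\<dots> \<le> 2" using powr_mono[of \<gamma> 1 2] \<gamma> by simp
    finally have "max (t - s) 0 powr \<gamma> \<le> 2" .
    moreover have "0 \<le> max (- s) 0 powr \<gamma>" by simp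
    ultimately show ?thesis using 2 mono by (simp add: kernel_bound_def del: powr_ge_zero)
  next
    case 3
    define z where "z = t / (- s)"
    have z: "0 \<le> z" using t 3 by (simp add: z_def divide_nonneg_neg)
    have "t - s = (- s) * (1 + z)" using 3 by (simp add: z_def field_simps)
    hence "(t - s) powr \<gamma> = ((- s) * (1 + z)) powr \<gamma>" by simp
    also have "\<dots> = (- s) powr \<gamma> * (1 + z) powr \<gamma>" using 3 z by (intro powr_mult)
    \<comment> \<open>This crude linear bound leaves the increment
      \<open>t * (- s) powr (\<gamma> - 1)\<close>, which already has the right order in
      \<open>s\<close>.\<close>
    also have "(1 + z) powr \<gamma> \<le> (1 + z) powr 1" using z \<gamma> by (intro powr_mono) auto
    also have "(1 + z) powr 1 = 1 + z" using z by simp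
    finally have "(t - s) powr \<gamma> \<le> (- s) powr \<gamma> * (1 + z)" using 3 by (simp add: mult_left_mono)
    also have "\<dots> = (- s) powr \<gamma> + t * (- s) powr (\<gamma> - 1)" using 3 by (simp add: z_def powr_diff field_simps)
    also have "t * (- s) powr (\<gamma> - 1) \<le> (- s) powr (\<gamma> - 1)" using t by (intro mult_left_le_one_le) auto
    finally show ?thesis using 3 t mono by (simp add: kernel_bound_def max_def)
  qed
qed

lemma lpow_kernel_bound_finite:
  assumes "0 < p" "1 < p * (1 - \<gamma>)"
  shows "lpow p (kernel_bound \<gamma>) < \<infinity>"
proof -
  have "lpow p (kernel_bound \<gamma>) \<le> (\<integral>\<^sup>+s. ennreal (2 powr p) * indicator {-1..1} s + ennreal ((- s) powr (- (p * (1 - \<gamma>)))) * indicator {..-1} s \<partial>lborel)"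
    unfolding lpow_def
    by (intro nn_integral_mono) (auto simp: kernel_bound_def indicator_def powr_powr algebra_simps)
  also have "\<dots> = ennreal (2 powr p) * emeasure lborel {-1..1::real} + ennreal (1 / (p * (1 - \<gamma>) - 1))"
    by (subst nn_integral_add, simp, simp, subst nn_integral_cmult_indicator, simp, subst nn_integral_powr_neg[OF assms(2)], rule refl)
  also have "\<dots> < \<infinity>" by (simp add: ennreal_mult_less_top)
  finally show ?thesis .
qed

subsection \<open>The fractional integral of the wavelet\<close>

locale wavelet =
  fixes \<psi> :: "real \<Rightarrow> real" and \<gamma> :: real
  assumes cont: "continuous_on UNIV \<psi>" and supp: "\<And>x. x \<notin> {0..1} \<Longrightarrow> \<psi> x = 0"
    and nonzero: "\<exists>x. \<psi> x \<noteq> 0"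
    and moment0: "(\<integral>y. \<psi> y \<partial>lborel) = 0" and moment1: "(\<integral>y. y * \<psi> y \<partial>lborel) = 0"
    and gamma: "0 < \<gamma>" "\<gamma> < 1"
begin

lemma psi_measurable [measurable]: "\<psi> \<in> borel_measurable borel"
  using cont by (rule borel_measurable_continuous_onI)

definition psi_bound :: real where "psi_bound = (SOME B. \<forall>y. \<bar>\<psi> y\<bar> \<le> B)"

lemma abs_psi_le: "\<bar>\<psi> y\<bar> \<le> psi_bound"
proof -
  have "compact (\<psi> ` {0..1})" using cont continuous_on_subset by (intro compact_continuous_image) auto
  then obtain B where B: "\<forall>y\<in>{0..1}. \<bar>\<psi> y\<bar> \<le> B"
    by (auto dest!: compact_imp_bounded simp: bounded_iff)
  have "\<bar>\<psi> y\<bar> \<le> max B 0" for y using B supp[of y] by (cases "y \<in> {0..1}") (auto intro: max.coboundedI1)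
  hence "\<exists>B. \<forall>y. \<bar>\<psi> y\<bar> \<le> B" by blast
  from someI_ex[OF this] show ?thesis by (simp add: psi_bound_def)
qed

lemma psi_bound_nonneg: "0 \<le> psi_bound"
  using abs_psi_le[of 0] by linarith

lemma integrable_mult_psi:
  assumes [measurable]: "f \<in> borel_measurable borel" and B: "\<And>y. 0 \<le> y \<Longrightarrow> y \<le> 1 \<Longrightarrow> \<bar>f y\<bar> \<le> B"
  shows "integrable lborel (\<lambda>y. f y * \<psi> y)" "\<bar>\<integral>y. f y * \<psi> y \<partial>lborel\<bar> \<le> B * psi_bound"
proof -
  have B0: "0 \<le> B" using B[of 0] by linarith
  have le: "\<bar>f y * \<psi> y\<bar> \<le> B * psi_bound * indicator {0..1} y" for y
    using mult_mono[OF B abs_psi_le B0, of y y] supp[of y] by (auto simp: indicator_def abs_mult)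
  have int: "integrable lborel (\<lambda>y. B * psi_bound * indicator {0..1::real} y)" by simp
  show 1: "integrable lborel (\<lambda>y. f y * \<psi> y)"
    by (rule Bochner_Integration.integrable_bound[OF int]) (use le in \<open>auto intro!: AE_I2 order_trans[OF le]\<close>)
  have "\<bar>\<integral>y. f y * \<psi> y \<partial>lborel\<bar> \<le> (\<integral>y. \<bar>f y * \<psi> y\<bar> \<partial>lborel)" by (rule integral_abs_bound)
  also have "\<dots> \<le> (\<integral>y. B * psi_bound * indicator {0..1::real} y \<partial>lborel)"
    using 1 int le by (intro integral_mono integrable_abs)
  also have "\<dots> = B * psi_bound" by simp
  finally show "\<bar>\<integral>y. f y * \<psi> y \<partial>lborel\<bar> \<le> B * psi_bound" .
qed

text \<open>If all moments vanish, then \<open>\<psi>\<close> is orthogonal to all polynomials and hence to itself.\<close>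

lemma moments_nonzero: "\<exists>n. (\<integral>y. y ^ n * \<psi> y \<partial>lborel) \<noteq> 0"
proof (rule ccontr)
  assume "\<not> ?thesis"
  hence mom: "(\<integral>y. y ^ n * \<psi> y \<partial>lborel) = 0" for n by auto
  have int_pow: "integrable lborel (\<lambda>y. y ^ n * \<psi> y)" for n
    by (rule integrable_mult_psi[where B = 1]) (auto simp: power_le_one)
  have int_sq: "integrable lborel (\<lambda>y. \<psi> y * \<psi> y)"
    by (rule integrable_mult_psi[where B = psi_bound]) (auto simp: abs_psi_le)
  have sq: "(\<integral>y. \<psi> y * \<psi> y \<partial>lborel) \<le> e * psi_bound" if e: "0 < e" for e
  proof -
    obtain g where g: "real_polynomial_function g" "\<And>x. x \<in> {0..1} \<Longrightarrow> \<bar>\<psi> x - g x\<bar> < e"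
      using Stone_Weierstrass_real_polynomial_function[of "{0..1}" \<psi> e] cont e continuous_on_subset by blast
    then obtain a n where gs: "g = (\<lambda>x. \<Sum>i\<le>n. a i * x ^ i)" by (auto simp: real_polynomial_function_iff_sum)
    have eq: "(\<lambda>y. g y * \<psi> y) = (\<lambda>y. \<Sum>i\<le>n. a i * (y ^ i * \<psi> y))"
      by (simp add: gs sum_distrib_right mult.assoc)
    have "integrable lborel (\<lambda>y. g y * \<psi> y)" unfolding eq using int_pow by simp
    moreover have "(\<integral>y. g y * \<psi> y \<partial>lborel) = 0" unfolding eq using int_pow mom by simp
    ultimately have "(\<integral>y. \<psi> y * \<psi> y \<partial>lborel) = (\<integral>y. \<psi> y * \<psi> y - g y * \<psi> y \<partial>lborel)"
      using int_sq by simp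
    also have "\<dots> = (\<integral>y. (\<psi> y - g y) * \<psi> y \<partial>lborel)" by (simp add: algebra_simps)
    also have "\<dots> \<le> e * psi_bound"
    proof -
      have [measurable]: "g \<in> borel_measurable borel" unfolding gs by measurable
      have "\<bar>\<integral>y. (\<psi> y - g y) * \<psi> y \<partial>lborel\<bar> \<le> e * psi_bound"
        using g(2) by (intro integrable_mult_psi) (auto intro: less_imp_le)
      thus ?thesis by linarith
    qed
    finally show ?thesis .
  qed
  have "(\<integral>y. \<psi> y * \<psi> y \<partial>lborel) \<le> 0"
  proof (rule tendsto_lowerbound)
    show "((\<lambda>e. e * psi_bound) \<longlongrightarrow> 0) (at_right 0)" by (auto intro!: tendsto_eq_intros)
    show "eventually (\<lambda>e. (\<integral>y. \<psi> y * \<psi> y \<partial>lborel) \<le> e * psi_bound) (at_right 0)"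
      by (intro eventually_at_rightI[of 0 1] sq) auto
  qed auto
  moreover have "0 \<le> (\<integral>y. \<psi> y * \<psi> y \<partial>lborel)" by (intro integral_nonneg_AE AE_I2) simp
  ultimately have "(\<integral>y. \<psi> y * \<psi> y \<partial>lborel) = 0" by linarith
  \<comment> \<open>The set where \<open>\<psi>\<close> is nonzero is now null and, by continuity,
    open; hence it is empty, against \<open>nonzero\<close>. Passing to the completed measure
    matches the notion of a negligible set.\<close>
  hence "AE y in lborel. \<psi> y * \<psi> y = 0"
    using int_sq by (subst (asm) integral_nonneg_eq_0_iff_AE) auto
  hence "emeasure lborel {y. \<psi> y \<noteq> 0} = 0" by (subst (asm) AE_iff_measurable[OF _ refl]) auto
  hence "{y. \<psi> y \<noteq> 0} \<in> null_sets lebesgue" by (intro null_sets_completionI) auto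
  hence "negligible {y. \<psi> y \<noteq> 0}" by (simp add: negligible_iff_null_sets)
  moreover have "open {y. \<psi> y \<noteq> 0}"
    using cont by (intro open_Collect_neq) (auto intro: continuous_on_const)
  ultimately show False using nonzero open_not_negligible[of "{y. \<psi> y \<noteq> 0}"] by auto
qed

text \<open>Up to the factor \<open>Gamma (\<gamma> + 1)\<close> this is the Weyl fractional
  integral of \<open>\<psi>\<close> of order \<open>\<gamma> + 1\<close>; it is the
  \<open>\<Psi>\<close> of the overview.\<close>

definition frac_psi :: "real \<Rightarrow> real" where
  "frac_psi x = (\<integral>y. max (y - x) 0 powr \<gamma> * \<psi> y \<partial>lborel)"

lemma integrable_frac_psi: "integrable lborel (\<lambda>y. max (y - x) 0 powr \<gamma> * \<psi> y)"
proof (rule integrable_mult_psi[where B = "(1 + \<bar>x\<bar>) powr \<gamma>"])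
  show "\<bar>max (y - x) 0 powr \<gamma>\<bar> \<le> (1 + \<bar>x\<bar>) powr \<gamma>" if "0 \<le> y" "y \<le> 1" for y
    using that gamma by (auto intro!: powr_mono2)
qed measurable

lemma frac_psi_measurable [measurable]: "frac_psi \<in> borel_measurable borel"
  unfolding frac_psi_def by measurable

lemma frac_psi_eq_0: "1 \<le> x \<Longrightarrow> frac_psi x = 0"
  unfolding frac_psi_def
  by (rule integral_eq_zero_AE) (use supp in \<open>auto intro!: AE_I2 simp: max_def\<close>)

lemma abs_frac_psi_le: "-2 \<le> x \<Longrightarrow> \<bar>frac_psi x\<bar> \<le> 3 * psi_bound"
  unfolding frac_psi_def
proof (rule integrable_mult_psi)
  fix y :: real assume y: "-2 \<le> x" "0 \<le> y" "y \<le> 1"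
  have "max (y - x) 0 powr \<gamma> \<le> 3 powr \<gamma>" using y gamma by (intro powr_mono2) auto
  also have "\<dots> \<le> 3" using powr_mono[of \<gamma> 1 3] gamma by simp
  finally show "\<bar>max (y - x) 0 powr \<gamma>\<bar> \<le> 3" by simp
qed measurable

text \<open>With \<open>h = - 1 / x\<close> one has \<open>(y - x) powr \<gamma> = h powr - \<gamma> * (1 + h y) powr \<gamma>\<close>.\<close>

lemma frac_psi_expansion:
  obtains C where "0 \<le> C" "\<And>x. x \<le> -2 \<Longrightarrow>
    \<bar>(- x) powr (- \<gamma>) * frac_psi x - (\<Sum>i\<le>n. (\<gamma> gchoose i) * (- 1 / x) ^ i * (\<integral>y. y ^ i * \<psi> y \<partial>lborel))\<bar> \<le> C * (- 1 / x) ^ Suc n"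
proof -
  obtain C where C: "0 \<le> C" "\<And>z. 0 \<le> z \<Longrightarrow> z \<le> 1/2 \<Longrightarrow> \<bar>(1 + z) powr \<gamma> - (\<Sum>i\<le>n. (\<gamma> gchoose i) * z ^ i)\<bar> \<le> C * z ^ Suc n"
    using binomial_remainder by blast
  show thesis
  proof (rule that[of "C * psi_bound"])
    show "0 \<le> C * psi_bound" using C psi_bound_nonneg by simp
    fix x :: real assume x: "x \<le> -2"
    define h where "h = - 1 / x"
    have h: "0 < h" "h \<le> 1/2" using x by (auto simp: h_def field_simps)
    have int_pow: "integrable lborel (\<lambda>y. y ^ n * \<psi> y)" for n
      by (rule integrable_mult_psi[where B = 1]) (auto simp: power_le_one)
    have "(- x) powr (- \<gamma>) * frac_psi x = (\<integral>y. (- x) powr (- \<gamma>) * (max (y - x) 0 powr \<gamma> * \<psi> y) \<partial>lborel)"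
      unfolding frac_psi_def by simp
    moreover have "(\<Sum>i\<le>n. (\<gamma> gchoose i) * h ^ i * (\<integral>y. y ^ i * \<psi> y \<partial>lborel))
       = (\<integral>y. (\<Sum>i\<le>n. (\<gamma> gchoose i) * h ^ i * (y ^ i * \<psi> y)) \<partial>lborel)"
      using int_pow by simp
    ultimately have "(- x) powr (- \<gamma>) * frac_psi x - (\<Sum>i\<le>n. (\<gamma> gchoose i) * h ^ i * (\<integral>y. y ^ i * \<psi> y \<partial>lborel))
       = (\<integral>y. (- x) powr (- \<gamma>) * (max (y - x) 0 powr \<gamma> * \<psi> y) - (\<Sum>i\<le>n. (\<gamma> gchoose i) * h ^ i * (y ^ i * \<psi> y)) \<partial>lborel)"
      using integrable_frac_psi[of x] int_pow by simp
    also have "\<dots> = (\<integral>y. ((- x) powr (- \<gamma>) * max (y - x) 0 powr \<gamma> - (\<Sum>i\<le>n. (\<gamma> gchoose i) * (h * y) ^ i)) * \<psi> y \<partial>lborel)"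
      by (simp add: left_diff_distrib right_diff_distrib sum_distrib_left sum_distrib_right power_mult_distrib mult_ac)
    also have "\<bar>\<dots>\<bar> \<le> C * h ^ Suc n * psi_bound"
    proof (rule integrable_mult_psi)
      fix y :: real assume y: "0 \<le> y" "y \<le> 1"
      have "y - x = (- x) * (1 + h * y)" using x by (simp add: h_def field_simps)
      moreover have hy: "0 \<le> h * y" "h * y \<le> h" using h y by (auto simp: mult_le_cancel_left1)
      moreover have "0 < (- x) * (1 + h * y)" using x hy by (intro mult_pos_pos) auto
      ultimately have "max (y - x) 0 = (- x) * (1 + h * y)" by simp
      hence "max (y - x) 0 powr \<gamma> = (- x) powr \<gamma> * (1 + h * y) powr \<gamma>"
        by (simp only: powr_mult)
      hence "(- x) powr (- \<gamma>) * max (y - x) 0 powr \<gamma> = (1 + h * y) powr \<gamma>"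
        using x by (simp add: powr_minus field_simps)
      hence "\<bar>(- x) powr (- \<gamma>) * max (y - x) 0 powr \<gamma> - (\<Sum>i\<le>n. (\<gamma> gchoose i) * (h * y) ^ i)\<bar> \<le> C * (h * y) ^ Suc n"
        using C(2)[of "h * y"] hy h by simp
      also have "\<dots> \<le> C * h ^ Suc n" using hy C h by (intro mult_left_mono power_mono) auto
      finally show "\<bar>(- x) powr (- \<gamma>) * max (y - x) 0 powr \<gamma> - (\<Sum>i\<le>n. (\<gamma> gchoose i) * (h * y) ^ i)\<bar> \<le> C * h ^ Suc n" .
    qed measurable
    finally show "\<bar>(- x) powr (- \<gamma>) * frac_psi x - (\<Sum>i\<le>n. (\<gamma> gchoose i) * (- 1 / x) ^ i * (\<integral>y. y ^ i * \<psi> y \<partial>lborel))\<bar>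
       \<le> C * psi_bound * (- 1 / x) ^ Suc n"
      by (simp only: h_def mult_ac)
  qed
qed

text \<open>The terms of order 0 and 1 of the expansion are multiples of the two vanishing moments.
  A remainder of order \<open>(- 1 / x)^2\<close> is left and is multiplied back by
  \<open>(- x) powr \<gamma>\<close>.\<close>

lemma frac_psi_decay:
  obtains C where "0 \<le> C" "\<And>x. x \<le> -2 \<Longrightarrow> \<bar>frac_psi x\<bar> \<le> C * (- x) powr (\<gamma> - 2)"
proof -
  obtain C where C: "0 \<le> C" "\<And>x. x \<le> -2 \<Longrightarrow>
    \<bar>(- x) powr (- \<gamma>) * frac_psi x - (\<Sum>i\<le>1. (\<gamma> gchoose i) * (- 1 / x) ^ i * (\<integral>y. y ^ i * \<psi> y \<partial>lborel))\<bar> \<le> C * (- 1 / x) ^ Suc 1"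
    using frac_psi_expansion[of 1] by blast
  show thesis
  proof (rule that[OF C(1)])
    fix x :: real assume x: "x \<le> -2"
    have "(\<Sum>i\<le>1. (\<gamma> gchoose i) * (- 1 / x) ^ i * (\<integral>y. y ^ i * \<psi> y \<partial>lborel)) = 0"
      using moment0 moment1 by (simp add: atMost_Suc)
    with C(2)[OF x] have "(- x) powr (- \<gamma>) * \<bar>frac_psi x\<bar> \<le> C * (- 1 / x) ^ 2"
      by (simp add: abs_mult numeral_2_eq_2)
    hence "(- x) powr \<gamma> * ((- x) powr (- \<gamma>) * \<bar>frac_psi x\<bar>) \<le> (- x) powr \<gamma> * (C * (- 1 / x) ^ 2)"
      by (intro mult_left_mono) auto
    also have "(- x) powr \<gamma> * ((- x) powr (- \<gamma>) * \<bar>frac_psi x\<bar>) = \<bar>frac_psi x\<bar>"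
      using x by (simp add: powr_minus)
    also have "(- x) powr \<gamma> * (C * (- 1 / x) ^ 2) = C * (- x) powr (\<gamma> - 2)"
      using x by (simp add: powr_diff powr_numeral power_divide)
    finally show "\<bar>frac_psi x\<bar> \<le> C * (- x) powr (\<gamma> - 2)" .
  qed
qed

text \<open>
  By the binomial expansion, the first non-vanishing moment of \<open>\<psi>\<close> determines the behaviour of \<^term>\<open>frac_psi\<close>
  at \<open>- \<infinity>\<close>, so \<^term>\<open>frac_psi\<close> cannot vanish almost everywhere.
\<close>

lemma lpow_frac_psi_pos:
  shows "0 < lpow p frac_psi"
proof (rule ccontr)
  assume "\<not> ?thesis"
  hence "lpow p frac_psi = 0" by simp
  hence ae: "AE x in lborel. frac_psi x = 0"
    unfolding lpow_def by (subst (asm) nn_integral_0_iff_AE) auto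
  have far: "\<exists>x\<le>- R. frac_psi x = 0" for R
  proof (rule ccontr)
    assume n: "\<not> ?thesis"
    from ae have "AE x in lborel. x \<notin> {- R - 1..- R}" by eventually_elim (use n in force)
    hence "emeasure lborel {- R - 1..- R} = 0" by (subst (asm) AE_iff_measurable[where N = "{- R - 1..- R}"]) auto
    thus False by simp
  qed
  define m where "m i = (\<integral>y. y ^ i * \<psi> y \<partial>lborel)" for i
  define n where "n = (LEAST n. m n \<noteq> 0)"
  have n: "m n \<noteq> 0" unfolding n_def
    by (rule LeastI_ex[where P = "\<lambda>n. m n \<noteq> 0"]) (use moments_nonzero in \<open>simp add: m_def\<close>)
  have less: "m i = 0" if "i < n" for i
    using not_less_Least[of i "\<lambda>n. m n \<noteq> 0"] that unfolding n_def by blast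
  obtain C where C: "0 \<le> C" "\<And>x. x \<le> -2 \<Longrightarrow>
    \<bar>(- x) powr (- \<gamma>) * frac_psi x - (\<Sum>i\<le>n. (\<gamma> gchoose i) * (- 1 / x) ^ i * m i)\<bar> \<le> C * (- 1 / x) ^ Suc n"
    using frac_psi_expansion[of n] unfolding m_def by blast
  define c where "c = \<bar>(\<gamma> gchoose n) * m n\<bar>"
  have c0: "0 < c" using n gbinomial_nonzero[OF gamma, of n] by (simp add: c_def)
  \<comment> \<open>At a zero of \<open>frac_psi\<close> the leading term must be absorbed by the
    remainder, which forces \<open>c * (- x) \<le> C\<close>. The zero is taken so far out that
    \<open>c * (- x) \<ge> 2 * c + C + 1\<close>.\<close>
  obtain x where x: "x \<le> - (2 + (C + 1) / c)" "frac_psi x = 0" using far by blast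
  have x2: "x \<le> -2"
  proof -
    have "0 \<le> (C + 1) / c" using c0 C(1) by simp
    thus ?thesis using x(1) by linarith
  qed
  have "(\<Sum>i\<le>n. (\<gamma> gchoose i) * (- 1 / x) ^ i * m i) = (\<gamma> gchoose n) * (- 1 / x) ^ n * m n"
    using less by (subst sum.remove[of _ n]) (auto intro!: sum.neutral)
  with C(2)[OF x2] x(2) have "\<bar>(\<gamma> gchoose n) * (- 1 / x) ^ n * m n\<bar> \<le> C * (- 1 / x) ^ Suc n" by simp
  moreover have "\<bar>(\<gamma> gchoose n) * (- 1 / x) ^ n * m n\<bar> = c * (- 1 / x) ^ n"

  proof -
    have "\<bar>(\<gamma> gchoose n) * w * m n\<bar> = c * w" if "0 \<le> w" for w using that by (simp add: c_def abs_mult)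
    moreover have "0 \<le> (- 1 / x) ^ n" using x2 by (intro zero_le_power) (simp add: divide_simps)
    ultimately show ?thesis .
  qed
  ultimately have "c * (- 1 / x) ^ n \<le> (C * (- 1 / x)) * (- 1 / x) ^ n" by (simp add: mult_ac)
  moreover have "0 < (- 1 / x) ^ n" using x2 by (intro zero_less_power) (simp add: divide_simps)
  ultimately have "c \<le> C * (- 1 / x)" by (rule mult_right_le_imp_le)
  hence "c * (- x) \<le> C" using x2 by (simp add: field_simps)
  moreover have "c * (2 + (C + 1) / c) \<le> c * (- x)" using x c0 by (intro mult_left_mono) auto
  moreover have "c * (2 + (C + 1) / c) = 2 * c + C + 1" using c0 by (simp add: field_simps)
  ultimately show False using c0 by linarith
qed

lemma lpow_frac_psi_finite:
  assumes p: "0 < p" "1 < p * (1 - \<gamma>)"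
  shows "lpow p frac_psi < \<infinity>"
proof -
  obtain C where C: "0 \<le> C" "\<And>x. x \<le> -2 \<Longrightarrow> \<bar>frac_psi x\<bar> \<le> C * (- x) powr (\<gamma> - 2)"
    using frac_psi_decay by blast
  define D where "D = max C (3 * psi_bound)"
  have D: "C \<le> D" "3 * psi_bound \<le> D" "0 \<le> D" using psi_bound_nonneg by (auto simp: D_def)
  have "\<bar>frac_psi x\<bar> \<le> D * kernel_bound \<gamma> x + D * indicator {-2..1} x" for x
  proof -
    consider "1 \<le> x" | "-2 \<le> x" "x < 1" | "x < -2" by linarith
    thus ?thesis
    proof cases
      case 1
      thus ?thesis using D kernel_bound_nonneg by (simp add: frac_psi_eq_0)
    next
      case 2
      have "0 \<le> D * kernel_bound \<gamma> x" using D(3) kernel_bound_nonneg by (rule mult_nonneg_nonneg)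
      moreover have "\<bar>frac_psi x\<bar> \<le> D" using abs_frac_psi_le[OF 2(1)] D(2) by linarith
      ultimately show ?thesis using 2 by simp
    next
      case 3
      have "\<bar>frac_psi x\<bar> \<le> C * (- x) powr (\<gamma> - 2)" using C 3 by auto
      \<comment> \<open>The decay is weakened on purpose, so that the integrability of
        \<open>kernel_bound\<close> can be reused.\<close>
      also have "\<dots> \<le> D * (- x) powr (\<gamma> - 1)" using 3 D by (intro mult_mono powr_mono) auto
      finally show ?thesis using 3 by (simp add: kernel_bound_def)
    qed
  qed
  hence "\<bar>frac_psi x\<bar> powr p \<le> (2 * D) powr p * (\<bar>kernel_bound \<gamma> x\<bar> powr p + indicator {-2..1} x)" for x
  proof -
    have k0: "0 \<le> kernel_bound \<gamma> x" by (rule kernel_bound_nonneg)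
    have "\<bar>frac_psi x\<bar> \<le> 2 * D * max (kernel_bound \<gamma> x) (indicator {-2..1} x)"
    proof -
      have "D * kernel_bound \<gamma> x \<le> D * max (kernel_bound \<gamma> x) (indicator {-2..1} x)"
        "D * indicator {-2..1} x \<le> D * max (kernel_bound \<gamma> x) (indicator {-2..1} x)"
        using D by (auto intro!: mult_left_mono)
      thus ?thesis using \<open>\<bar>frac_psi x\<bar> \<le> D * kernel_bound \<gamma> x + D * indicator {-2..1} x\<close> by linarith
    qed
    hence "\<bar>frac_psi x\<bar> powr p \<le> (2 * D * max (kernel_bound \<gamma> x) (indicator {-2..1} x)) powr p"
      using p by (intro powr_mono2) auto
    also have "\<dots> = (2 * D) powr p * max (kernel_bound \<gamma> x) (indicator {-2..1} x) powr p"
      using k0 D by (intro powr_mult)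
    also have "\<dots> \<le> (2 * D) powr p * (\<bar>kernel_bound \<gamma> x\<bar> powr p + indicator {-2..1} x)"
      using k0 by (intro mult_left_mono) (auto simp: max_def indicator_def)
    finally show ?thesis .
  qed
  hence "lpow p frac_psi \<le> (\<integral>\<^sup>+x. ennreal ((2 * D) powr p) * (ennreal (\<bar>kernel_bound \<gamma> x\<bar> powr p) + indicator {-2..1} x) \<partial>lborel)"
    unfolding lpow_def
    by (intro nn_integral_mono) (auto simp: ennreal_mult[symmetric] ennreal_indicator[symmetric] ennreal_plus[symmetric] simp del: ennreal_plus intro!: ennreal_leI)
  also have "\<dots> = ennreal ((2 * D) powr p) * (lpow p (kernel_bound \<gamma>) + emeasure lborel {-2..1::real})"
    unfolding lpow_def by (subst nn_integral_cmult, simp, subst nn_integral_add) auto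
  also have "\<dots> < \<infinity>" using lpow_kernel_bound_finite[OF p] by (simp add: ennreal_mult_less_top)
  finally show ?thesis .
qed

text \<open>
  In the exponent \<open>p * (\<gamma> - 2) = - p - p * (1 - \<gamma>)\<close> the second part is already integrable at infinity. The
  resulting bound \<open>R powr - p\<close> is not sharp, but \<open>p > 1\<close> is all that is needed below.
\<close>

lemma lpow_frac_psi_tail:
  assumes p: "0 < p" "1 < p * (1 - \<gamma>)"
  obtains C where "0 \<le> C" "\<And>R. 2 \<le> R \<Longrightarrow> lpow p (\<lambda>x. frac_psi x * indicator {..- R} x) \<le> ennreal (C * R powr (- p))"
proof -
  obtain C where C: "0 \<le> C" "\<And>x. x \<le> -2 \<Longrightarrow> \<bar>frac_psi x\<bar> \<le> C * (- x) powr (\<gamma> - 2)"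
    using frac_psi_decay by blast
  define q where "q = p * (1 - \<gamma>)"
  show thesis
  proof (rule that)
    show "0 \<le> C powr p * (1 / (q - 1))" using p by (simp add: q_def)
    fix R :: real assume R: "2 \<le> R"
    have "\<bar>frac_psi x * indicator {..- R} x\<bar> powr p \<le> C powr p * R powr (- p) * ((- x) powr (- q) * indicator {..-1} x)" for x
    proof (cases "x \<le> - R")
      case True
      have "\<bar>frac_psi x\<bar> powr p \<le> (C * (- x) powr (\<gamma> - 2)) powr p" using C(2)[of x] True R p by (intro powr_mono2) auto
      also have "\<dots> = C powr p * (- x) powr (p * (\<gamma> - 2))" using C by (simp add: powr_mult powr_powr mult.commute)
      also have "p * (\<gamma> - 2) = - p + - q" by (simp add: q_def algebra_simps)
      also have "(- x) powr (- p + - q) = (- x) powr (- p) * (- x) powr (- q)" by (rule powr_add)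
      also have "C powr p * \<dots> \<le> C powr p * (R powr (- p) * (- x) powr (- q))"
        using True R p by (intro mult_left_mono mult_right_mono powr_mono2') auto
      finally show ?thesis using True R by (simp add: mult_ac)
    qed (use p in auto)
    hence "lpow p (\<lambda>x. frac_psi x * indicator {..- R} x) \<le> (\<integral>\<^sup>+x. ennreal (C powr p * R powr (- p)) * (ennreal ((- x) powr (- q)) * indicator {..-1} x) \<partial>lborel)"
      unfolding lpow_def
      by (intro nn_integral_mono) (auto simp: ennreal_mult[symmetric] ennreal_indicator[symmetric] simp del: ennreal_plus intro!: ennreal_leI)
    also have "\<dots> = ennreal (C powr p * R powr (- p)) * ennreal (1 / (q - 1))"
      using p by (subst nn_integral_cmult) (auto simp: nn_integral_powr_neg q_def)
    also have "\<dots> = ennreal (C powr p * (1 / (q - 1)) * R powr (- p))"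
      using p by (simp add: ennreal_mult[symmetric] mult_ac q_def)
    finally show "lpow p (\<lambda>x. frac_psi x * indicator {..- R} x) \<le> ennreal (C powr p * (1 / (q - 1)) * R powr (- p))" .
  qed
qed

end

subsection \<open>The wavelet coefficients\<close>

locale lfsm_wavelet = sas_random_measure_lt2 M \<alpha> Z + wavelet \<psi> "H - 1 / \<alpha>"
  for M :: "'a measure" and \<alpha> :: real and Z :: "real set \<Rightarrow> 'a \<Rightarrow> real"
    and \<psi> :: "real \<Rightarrow> real" and H :: real +
  fixes X :: "real \<Rightarrow> 'a \<Rightarrow> real"
  assumes alpha1: "1 < \<alpha>" and H: "H < 1" and X: "continuous_lfsm M H \<alpha> Z X"
begin

abbreviation "\<gamma> \<equiv> H - 1 / \<alpha>"

text \<open>The right-hand side equals \<open>1 + \<alpha> * (1 - H)\<close>, so this is the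
  assumption \<open>H < 1\<close>. It makes the kernels \<open>\<alpha>\<close>-integrable at minus
  infinity.\<close>

lemma decay_exponent: "1 < \<alpha> * (1 - \<gamma>)"
  using alpha1 H by (simp add: algebra_simps)

lemma X_cont: "\<omega> \<in> space M \<Longrightarrow> continuous_on UNIV (\<lambda>t. X t \<omega>)"
  using X by (simp add: continuous_lfsm_def)

lemma X_stable_approx: "stable_approx (lfsm_kernel H \<alpha> t) (X t)"
  using X by (intro stable_approx_has_stable_integral) (simp add: continuous_lfsm_def)

text \<open>The integrand that represents the wavelet coefficient as a stable integral. The argument
  is written \<open>2 ^ j * s + - real k\<close> to match the affine substitution in
  \<open>lpow_affine\<close>.\<close>

definition coeff_kernel :: "nat \<Rightarrow> nat \<Rightarrow> real \<Rightarrow> real" where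
  "coeff_kernel j k s = 2 powr (- (real j * \<gamma>)) * frac_psi (2 ^ j * s + - real k)"

lemma coeff_kernel_measurable [measurable]: "coeff_kernel j k \<in> borel_measurable borel"
  unfolding coeff_kernel_def by measurable

lemma wavelet_coeff_eq:
  "wavelet_coeff X \<psi> j k \<omega> = (\<integral>y. X ((real k + y) / 2 ^ j) \<omega> * \<psi> y \<partial>lborel)"
proof -
  have "(\<integral>t. X t \<omega> * \<psi> (2 ^ j * t - real k) \<partial>lborel)
      = \<bar>1 / 2 ^ j\<bar> *\<^sub>R (\<integral>y. X (real k / 2 ^ j + 1 / 2 ^ j * y) \<omega> * \<psi> (2 ^ j * (real k / 2 ^ j + 1 / 2 ^ j * y) - real k) \<partial>lborel)"
    by (rule lborel_integral_real_affine) simp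
  also have "\<dots> = 1 / 2 ^ j * (\<integral>y. X ((real k + y) / 2 ^ j) \<omega> * \<psi> y \<partial>lborel)"
    by (simp add: algebra_simps add_divide_distrib)
  finally show ?thesis by (simp add: wavelet_coeff_def)
qed

text \<open>Nodes and weights are those of \<open>coeff_kernel_LIMSEQ\<close>, so for each
  \<open>n\<close> the random sum is a stable integral of the corresponding sum of kernels.\<close>

lemma wavelet_coeff_LIMSEQ:
  assumes "\<omega> \<in> space M"
  shows "(\<lambda>n. \<Sum>i<n. \<psi> (real i / real n) / real n * X ((real k + real i / real n) / 2 ^ j) \<omega>)
    \<longlonglongrightarrow> wavelet_coeff X \<psi> j k \<omega>"
proof -
  have "continuous_on UNIV (\<lambda>y. X ((real k + y) / 2 ^ j) \<omega>)"
    by (rule continuous_on_compose2[OF X_cont[OF assms]]) (auto intro!: continuous_intros)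
  hence "continuous_on UNIV (\<lambda>y. X ((real k + y) / 2 ^ j) \<omega> * \<psi> y)"
    using cont by (intro continuous_on_mult)
  from riemann_sum_LIMSEQ[OF this] supp show ?thesis
    by (simp add: wavelet_coeff_eq mult.commute)
qed

lemma coeff_kernel_LIMSEQ:
  "(\<lambda>n. \<Sum>i<n. \<psi> (real i / real n) / real n * lfsm_kernel H \<alpha> ((real k + real i / real n) / 2 ^ j) s)
    \<longlonglongrightarrow> coeff_kernel j k s"
proof -
  let ?K = "\<lambda>y. lfsm_kernel H \<alpha> ((real k + y) / 2 ^ j) s"
  have "continuous_on UNIV ?K"
    unfolding lfsm_kernel_def using gamma by (intro continuous_intros continuous_on_powr') auto
  hence "continuous_on UNIV (\<lambda>y. ?K y * \<psi> y)"
    using cont by (intro continuous_on_mult)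
  from riemann_sum_LIMSEQ[OF this] supp
  have "(\<lambda>n. \<Sum>i<n. \<psi> (real i / real n) / real n * lfsm_kernel H \<alpha> ((real k + real i / real n) / 2 ^ j) s)
    \<longlonglongrightarrow> (\<integral>y. ?K y * \<psi> y \<partial>lborel)"
    by (simp add: mult.commute)
  also have "(\<integral>y. ?K y * \<psi> y \<partial>lborel) = coeff_kernel j k s"
  proof -
    \<comment> \<open>Homogeneity of the power pulls out
      \<open>2 powr (- (real j * \<gamma>))\<close>. The second term of the kernel is constant in
      \<open>y\<close> and is removed by the vanishing zeroth moment.\<close>
    have "?K y * \<psi> y = 2 powr (- (real j * \<gamma>)) * (max (y - (2 ^ j * s + - real k)) 0 powr \<gamma> * \<psi> y) - max (- s) 0 powr \<gamma> * \<psi> y" for y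
    proof -
      have "max ((real k + y) / 2 ^ j - s) 0 = (1 / 2 ^ j) * max (y - (2 ^ j * s + - real k)) 0"
        by (auto simp: max_def field_simps)
      hence "max ((real k + y) / 2 ^ j - s) 0 powr \<gamma> = (1 / 2 ^ j) powr \<gamma> * max (y - (2 ^ j * s + - real k)) 0 powr \<gamma>"
        by (simp only: powr_mult)
      also have "(1 / 2 ^ j :: real) powr \<gamma> = 2 powr (- (real j * \<gamma>))"
        by (simp add: powr_realpow[symmetric] powr_minus[symmetric] powr_powr divide_inverse)
      finally show ?thesis by (simp add: lfsm_kernel_def algebra_simps)
    qed
    moreover have "integrable lborel \<psi>" using integrable_mult_psi(1)[of "\<lambda>_. 1" 1] by simp
    ultimately show ?thesis
      using integrable_frac_psi[of "2 ^ j * s + - real k"] moment0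
      by (simp add: coeff_kernel_def frac_psi_def)
  qed
  finally show ?thesis .
qed

text \<open>The restriction on \<open>k\<close> keeps all time points
  \<open>(k + i / n) / 2 ^ j\<close> in \<open>{0..1}\<close>. There \<open>kernel_bound\<close>
  dominates the Riemann sums uniformly in \<open>n\<close>, and dominated convergence gives the
  \<open>L^\<alpha>\<close> convergence of the kernels.\<close>

lemma stable_approx_wavelet_coeff:
  assumes k: "k < 2 ^ j"
  shows "stable_approx (coeff_kernel j k) (wavelet_coeff X \<psi> j k)"
proof -
  let ?t = "\<lambda>n i. (real k + real i / real n) / 2 ^ j"
  let ?w = "\<lambda>n i. \<psi> (real i / real n) / real n"
  let ?f = "\<lambda>n s. \<Sum>i<n. ?w n i * lfsm_kernel H \<alpha> (?t n i) s"
  let ?g = "kernel_bound \<gamma>"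
  have le: "\<bar>?f n s\<bar> \<le> psi_bound * ?g s" for n s
  proof -
    have "\<bar>?f n s\<bar> \<le> (\<Sum>i<n. \<bar>?w n i * lfsm_kernel H \<alpha> (?t n i) s\<bar>)" by (rule sum_abs)
    also have "\<dots> \<le> (\<Sum>i<n. psi_bound / real n * ?g s)"
    proof (intro sum_mono)
      fix i assume i: "i \<in> {..<n}"
      have "real k + 1 \<le> 2 ^ j" using k by (metis Suc_leI of_nat_Suc of_nat_le_iff of_nat_numeral of_nat_power add.commute)
      moreover have "real i / real n \<le> 1" using i by simp
      ultimately have "real k + real i / real n \<le> 2 ^ j" by linarith
      hence t: "0 \<le> ?t n i" "?t n i \<le> 1" by (auto simp: divide_simps)
      have "\<bar>?w n i\<bar> \<le> psi_bound / real n"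
        using abs_psi_le by (simp add: abs_divide divide_right_mono)
      moreover have "\<bar>lfsm_kernel H \<alpha> (?t n i) s\<bar> \<le> ?g s"
        unfolding lfsm_kernel_def using gamma t by (rule abs_kernel_le)
      ultimately show "\<bar>?w n i * lfsm_kernel H \<alpha> (?t n i) s\<bar> \<le> psi_bound / real n * ?g s"
        unfolding abs_mult using psi_bound_nonneg by (intro mult_mono) auto
    qed
    also have "\<dots> \<le> psi_bound * ?g s" using psi_bound_nonneg kernel_bound_nonneg[of \<gamma> s] by (cases "n = 0") auto
    finally show ?thesis .
  qed
  have le': "\<bar>coeff_kernel j k s\<bar> \<le> psi_bound * ?g s" for s
    by (rule tendsto_upperbound[OF tendsto_rabs[OF coeff_kernel_LIMSEQ]]) (use le in auto)
  have meas: "?f n \<in> borel_measurable borel" for n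
    unfolding lfsm_kernel_def by measurable
  have l: "(\<lambda>n. lpow \<alpha> (\<lambda>x. ?f n x - coeff_kernel j k x)) \<longlonglongrightarrow> 0"
  proof -
    have "(\<lambda>n. \<integral>\<^sup>+x. ennreal (\<bar>?f n x - coeff_kernel j k x\<bar> powr \<alpha>) \<partial>lborel) \<longlonglongrightarrow> (\<integral>\<^sup>+(x::real). 0 \<partial>lborel)"
    proof (rule nn_integral_dominated_convergence[where w = "\<lambda>x. ennreal (\<bar>(2 * psi_bound) * ?g x\<bar> powr \<alpha>)"])
      show "AE x in lborel. ennreal (\<bar>?f n x - coeff_kernel j k x\<bar> powr \<alpha>) \<le> ennreal (\<bar>(2 * psi_bound) * ?g x\<bar> powr \<alpha>)" for n
      proof (intro AE_I2 ennreal_leI powr_mono2)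
        fix x
        show "\<bar>?f n x - coeff_kernel j k x\<bar> \<le> \<bar>(2 * psi_bound) * ?g x\<bar>"
          using le[of n x] le'[of x] by linarith
      qed (use alpha in auto)
      have "(\<integral>\<^sup>+x. ennreal (\<bar>(2 * psi_bound) * ?g x\<bar> powr \<alpha>) \<partial>lborel) = ennreal (\<bar>2 * psi_bound\<bar> powr \<alpha>) * lpow \<alpha> ?g"
        by (subst lpow_cmult[symmetric]) (auto simp: lpow_def)
      also have "\<dots> < \<infinity>"
        using lpow_kernel_bound_finite[OF alpha(1) decay_exponent] by (simp add: ennreal_mult_less_top)
      finally show "(\<integral>\<^sup>+x. ennreal (\<bar>(2 * psi_bound) * ?g x\<bar> powr \<alpha>) \<partial>lborel) < \<infinity>" .
      show "AE x in lborel. (\<lambda>n. ennreal (\<bar>?f n x - coeff_kernel j k x\<bar> powr \<alpha>)) \<longlonglongrightarrow> 0"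
      proof (rule AE_I2)
        fix x
        have "(\<lambda>n. \<bar>?f n x - coeff_kernel j k x\<bar>) \<longlonglongrightarrow> 0"
          using tendsto_diff[OF coeff_kernel_LIMSEQ[of k j x] tendsto_const[of "coeff_kernel j k x"]]
          by (simp add: tendsto_rabs_zero_iff)
        hence "(\<lambda>n. \<bar>?f n x - coeff_kernel j k x\<bar> powr \<alpha>) \<longlonglongrightarrow> 0 powr \<alpha>"
          by (rule tendsto_powr'[OF _ tendsto_const]) (use alpha in auto)
        hence "(\<lambda>n. ennreal (\<bar>?f n x - coeff_kernel j k x\<bar> powr \<alpha>)) \<longlonglongrightarrow> ennreal 0"
          by (intro tendsto_ennrealI) simp
        thus "(\<lambda>n. ennreal (\<bar>?f n x - coeff_kernel j k x\<bar> powr \<alpha>)) \<longlonglongrightarrow> 0" by simp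
      qed
    qed (use meas in auto)
    thus ?thesis by (simp add: lpow_def)
  qed
  show ?thesis
  proof (rule stable_approx_limit[OF _ _ _ l wavelet_coeff_LIMSEQ])
    show "stable_approx (?f n) (\<lambda>\<omega>. \<Sum>i<n. ?w n i * X (?t n i) \<omega>)" for n
      by (intro stable_approx_sum X_stable_approx) auto
    show "wavelet_coeff X \<psi> j k \<in> borel_measurable M"
    proof (rule borel_measurable_LIMSEQ_real[OF wavelet_coeff_LIMSEQ])
      show "(\<lambda>\<omega>. \<Sum>i<n. ?w n i * X (?t n i) \<omega>) \<in> borel_measurable M" for n
        using stable_approxD(2)[OF X_stable_approx] by (intro borel_measurable_sum borel_measurable_times) auto
    qed
  qed simp
qed

lemma wavelet_coeff_measurable [measurable]:
  "k < 2 ^ j \<Longrightarrow> wavelet_coeff X \<psi> j k \<in> borel_measurable M"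
  using stable_approx_wavelet_coeff stable_approxD(2) by blast

text \<open>Self-similarity: the height contributes \<open>2 powr (- j \<gamma> \<alpha>)\<close>,
  the change of variables \<open>2 powr (- j)\<close>, and
  \<open>\<alpha> * \<gamma> + 1 = \<alpha> * H\<close>. The set \<open>A\<close> lives in the
  rescaled variable, so the same statement covers full kernels, windows and remainders.\<close>

lemma lpow_coeff_kernel:
  assumes [measurable]: "A \<in> sets borel"
  shows "lpow \<alpha> (\<lambda>s. coeff_kernel j k s * indicator {s. 2 ^ j * s + - real k \<in> A} s)
    = ennreal (2 powr (- (real j * (\<alpha> * H)))) * lpow \<alpha> (\<lambda>x. frac_psi x * indicator A x)"
proof -
  have "lpow \<alpha> (\<lambda>s. coeff_kernel j k s * indicator {s. 2 ^ j * s + - real k \<in> A} s)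
     = lpow \<alpha> (\<lambda>s. 2 powr (- (real j * \<gamma>)) * (\<lambda>x. frac_psi x * indicator A x) (2 ^ j * s + - real k))"
    by (intro arg_cong[where f = "lpow \<alpha>"] ext) (simp add: coeff_kernel_def indicator_def)
  also have "\<dots> = ennreal (\<bar>2 powr (- (real j * \<gamma>))\<bar> powr \<alpha>) * (ennreal (1 / 2 ^ j) * lpow \<alpha> (\<lambda>x. frac_psi x * indicator A x))"
    by (subst lpow_cmult, measurable, subst lpow_affine[where f = "\<lambda>x. frac_psi x * indicator A x"]) auto
  also have "\<dots> = ennreal (\<bar>2 powr (- (real j * \<gamma>))\<bar> powr \<alpha> * (1 / 2 ^ j)) * lpow \<alpha> (\<lambda>x. frac_psi x * indicator A x)"
    by (subst ennreal_mult) (auto simp: mult.assoc)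
  also have "\<bar>2 powr (- (real j * \<gamma>))\<bar> powr \<alpha> * (1 / 2 ^ j) = 2 powr (- (real j * \<gamma>) * \<alpha> + - real j)"
  proof -
    have "1 / 2 ^ j = 2 powr (- real j)" by (simp add: powr_minus powr_realpow divide_inverse)
    thus ?thesis by (simp only: powr_add powr_powr abs_of_nonneg[OF powr_ge_zero])
  qed
  also have "- (real j * \<gamma>) * \<alpha> + - real j = - (real j * (\<alpha> * H))"
    using alpha by (simp add: field_simps)
  finally show ?thesis .
qed

text \<open>This is the \<open>\<alpha>\<close>-th power of the norm. The value is finite and
  positive, so the conversion to a real number loses nothing.\<close>

definition frac_psi_norm :: real where "frac_psi_norm = enn2real (lpow \<alpha> frac_psi)"

lemma frac_psi_norm: "lpow \<alpha> frac_psi = ennreal frac_psi_norm" "0 < frac_psi_norm"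
  using lpow_frac_psi_finite[OF alpha(1) decay_exponent] lpow_frac_psi_pos[of \<alpha>]
  by (auto simp: frac_psi_norm_def enn2real_positive_iff)

section \<open>Upper bound for the maximal coefficient\<close>

lemma wavelet_coeff_tail:
  assumes "k < 2 ^ j" "0 < r"
  shows "prob {\<omega>\<in>space M. r < \<bar>wavelet_coeff X \<psi> j k \<omega>\<bar>}
     \<le> 128 * (2 powr (- (real j * (\<alpha> * H))) * frac_psi_norm) / r powr \<alpha>"
proof (rule stable_approx_tail[OF stable_approx_wavelet_coeff])
  show "lpow \<alpha> (coeff_kernel j k) \<le> ennreal (2 powr (- (real j * (\<alpha> * H))) * frac_psi_norm)"
    using lpow_coeff_kernel[of UNIV j k] frac_psi_norm by (simp add: ennreal_mult)
qed (use assms frac_psi_norm in auto)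

lemma AE_eventually_le:
  assumes \<epsilon>: "0 < \<epsilon>"
  shows "AE \<omega> in M. eventually (\<lambda>j. max_coeff X \<psi> j \<omega> \<le> 2 powr (real j * (\<epsilon> - \<gamma>))) sequentially"
proof -
  define r where "r j = (2::real) powr (real j * (\<epsilon> - \<gamma>))" for j :: nat
  define A where "A j = (\<Union>k\<in>{0..<2^j}. {\<omega>\<in>space M. r j < \<bar>wavelet_coeff X \<psi> j k \<omega>\<bar>})" for j
  have A: "A j \<in> events" for j unfolding A_def by (intro sets.finite_UN) auto
  have le: "prob (A j) \<le> 128 * frac_psi_norm * (2 powr (- (\<alpha> * \<epsilon>))) ^ j" for j
  proof -
    have "prob (A j) \<le> (\<Sum>k\<in>{0..<2^j}. prob {\<omega>\<in>space M. r j < \<bar>wavelet_coeff X \<psi> j k \<omega>\<bar>})"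
      unfolding A_def by (intro measure_UNION_le) auto
    also have "\<dots> \<le> (\<Sum>k\<in>{0..<2^j::nat}. 128 * (2 powr (- (real j * (\<alpha> * H))) * frac_psi_norm) / r j powr \<alpha>)"
      by (intro sum_mono wavelet_coeff_tail) (auto simp: r_def)
    also have "\<dots> = 128 * frac_psi_norm * (2 powr real j * 2 powr (- (real j * (\<alpha> * H))) / r j powr \<alpha>)"
      by (simp add: powr_realpow)
    also have "2 powr real j * 2 powr (- (real j * (\<alpha> * H))) / r j powr \<alpha>
       = 2 powr (real j + - (real j * (\<alpha> * H)) - real j * (\<epsilon> - \<gamma>) * \<alpha>)"
      by (simp only: r_def powr_powr powr_add powr_diff)
    \<comment> \<open>By \<open>\<alpha> * \<gamma> = \<alpha> * H - 1\<close> the number of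
      coefficients cancels against their scale, and only the margin \<open>\<epsilon>\<close>
      survives.\<close>
    also have "real j + - (real j * (\<alpha> * H)) - real j * (\<epsilon> - \<gamma>) * \<alpha> = - (\<alpha> * \<epsilon>) * real j"
      using alpha by (simp add: field_simps)
    also have "2 powr (- (\<alpha> * \<epsilon>) * real j) = (2 powr (- (\<alpha> * \<epsilon>))) ^ j"
      by (subst powr_powr[symmetric], subst powr_realpow) auto
    finally show ?thesis .
  qed
  have "2 powr (- (\<alpha> * \<epsilon>)) < (1::real)" using \<epsilon> alpha by (simp add: powr_less_one)
  hence "summable (\<lambda>j. 128 * frac_psi_norm * (2 powr (- (\<alpha> * \<epsilon>))) ^ j)"
    by (intro summable_mult summable_geometric) auto
  hence "summable (\<lambda>j. prob (A j))"
    by (rule summable_comparison_test'[where N = 0]) (use le in auto)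
  hence "AE \<omega> in M. eventually (\<lambda>j. \<omega> \<in> space M - A j) sequentially"
    by (intro borel_cantelli_AE1 A) (auto simp: emeasure_eq_measure)
  thus ?thesis
  proof eventually_elim
    case (elim \<omega>)
    thus ?case
    proof eventually_elim
      case (elim j)
      have "\<bar>wavelet_coeff X \<psi> j k \<omega>\<bar> \<le> r j" if "k \<in> {0..<2^j}" for k
        using elim that by (auto simp: A_def not_less)
      thus ?case unfolding max_coeff_def r_def[symmetric] by (subst Max_le_iff) auto
    qed
  qed
qed

section \<open>Lower bound for the maximal coefficient\<close>

text \<open>Once the left tail is below one eighth of the total mass \<open>N\<close>, the
  quasi-triangle inequality \<open>N \<le> 4 * (u + N / 8)\<close> leaves
  \<open>u \<ge> N / 8\<close> for the window. The bound must not depend on \<open>R\<close>,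
  because the windows grow with \<open>j\<close>.\<close>

lemma lpow_frac_psi_truncated:
  obtains a R0 where "0 < a" "2 \<le> R0" "\<And>R. R0 \<le> R \<Longrightarrow> ennreal a \<le> lpow \<alpha> (\<lambda>x. frac_psi x * indicator {- R<..1} x)"
proof -
  obtain C where C: "0 \<le> C" "\<And>R. 2 \<le> R \<Longrightarrow> lpow \<alpha> (\<lambda>x. frac_psi x * indicator {..- R} x) \<le> ennreal (C * R powr (- \<alpha>))"
    using lpow_frac_psi_tail[OF alpha(1) decay_exponent] by blast
  have "((\<lambda>R. C * R powr (- \<alpha>)) \<longlongrightarrow> C * 0) at_top"
    using alpha by (intro tendsto_mult tendsto_const tendsto_neg_powr filterlim_ident) auto
  hence "eventually (\<lambda>R. C * R powr (- \<alpha>) < frac_psi_norm / 8) at_top"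
    using frac_psi_norm by (intro order_tendstoD(2)) auto
  then obtain R1 where R1: "\<And>R. R1 \<le> R \<Longrightarrow> C * R powr (- \<alpha>) < frac_psi_norm / 8"
    by (auto simp: eventually_at_top_linorder)
  show thesis
  proof (rule that[of "frac_psi_norm / 8" "max 2 R1"])
    fix R assume R: "max 2 R1 \<le> R"
    let ?u = "\<lambda>x. frac_psi x * indicator {- R<..1} x"
    let ?v = "\<lambda>x. frac_psi x * indicator {..- R} x"
    have "frac_psi = (\<lambda>x. ?u x + ?v x)"
      using R by (auto simp: fun_eq_iff indicator_def frac_psi_eq_0)
    hence "lpow \<alpha> frac_psi \<le> 4 * (lpow \<alpha> ?u + lpow \<alpha> ?v)"
      using lpow_add_le[of ?u ?v \<alpha>] alpha by simp
    also have "\<dots> \<le> 4 * (lpow \<alpha> ?u + ennreal (frac_psi_norm / 8))"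
      using C(2)[of R] R1[of R] R by (intro mult_left_mono add_left_mono order_trans[OF C(2)] ennreal_leI) auto
    finally have le: "ennreal frac_psi_norm \<le> 4 * (lpow \<alpha> ?u + ennreal (frac_psi_norm / 8))"
      by (simp add: frac_psi_norm)
    show "ennreal (frac_psi_norm / 8) \<le> lpow \<alpha> ?u"
    proof (cases "lpow \<alpha> ?u")
      case (real u)
      have "4 * (ennreal u + ennreal (frac_psi_norm / 8)) = ennreal (4 * (u + frac_psi_norm / 8))"
        using real frac_psi_norm(2) by (simp add: ennreal_plus[symmetric] ennreal_numeral[symmetric] ennreal_mult[symmetric] del: ennreal_plus ennreal_numeral)
      with le have "ennreal frac_psi_norm \<le> ennreal (4 * (u + frac_psi_norm / 8))"
        unfolding real(2) by (simp only:)
      hence "frac_psi_norm \<le> 4 * (u + frac_psi_norm / 8)"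
        using frac_psi_norm(2) real(1) by (subst (asm) ennreal_le_iff) auto
      thus ?thesis using real frac_psi_norm(2) by (simp add: ennreal_leI)
    qed simp
  qed (use frac_psi_norm in auto)
qed

lemma prob_all_small:
  assumes C: "\<And>R. 2 \<le> R \<Longrightarrow> lpow \<alpha> (\<lambda>x. frac_psi x * indicator {..- R} x) \<le> ennreal (C * R powr (- \<alpha>))" "0 \<le> C"
    and a: "0 < a" "ennreal a \<le> lpow \<alpha> (\<lambda>x. frac_psi x * indicator {- (2 ^ l - 1)<..1} x)"
    and l: "2 \<le> l" "l \<le> j" and r: "0 < r"
    and small: "2 powr (- (real j * (\<alpha> * H))) * a / r powr \<alpha> \<le> 4 - 2 powr \<alpha>"
  shows "prob {\<omega>\<in>space M. max_coeff X \<psi> j \<omega> \<le> r}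
    \<le> exp (- (tail_const * (2 powr (- (real j * (\<alpha> * H))) * a / r powr \<alpha>)) * 2 ^ (j - l))
      + 2 ^ (j - l) * (32 * (2 powr (- (real j * (\<alpha> * H))) * (4 * C * 2 powr (- (real l * \<alpha>)))) / r powr \<alpha>)"
proof -
  define \<sigma> where "\<sigma> = 2 powr (- (real j * (\<alpha> * H)))"
  have \<sigma>: "0 < \<sigma>" by (simp add: \<sigma>_def)
  define L :: real where "L = 2 ^ l"
  \<comment> \<open>With \<open>l \<ge> 2\<close> one has \<open>L - 1 \<ge> 2\<close>, so the tail
    estimate applies at radius \<open>L - 1\<close>, and also
    \<open>L - 1 \<ge> L / 2\<close>.\<close>
  have "(2::real) ^ 2 \<le> 2 ^ l" using l by (intro power_increasing) auto
  hence L: "4 \<le> L" by (simp add: L_def)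
  define K where "K = {..<(2::nat) ^ (j - l)}"
  \<comment> \<open>In the rescaled variable the window is half-open of length exactly
    \<open>L\<close>, and consecutive sampled coefficients are shifted by \<open>L\<close>; so the
    windows tile without overlap.\<close>
  define A where "A m = {s::real. 2 ^ j * s + - real (m * 2 ^ l) \<in> {- (L - 1)<..1}}" for m :: nat
  have index: "m * 2 ^ l < 2 ^ j" if "m \<in> K" for m
  proof -
    have "m * 2 ^ l < 2 ^ (j - l) * 2 ^ l" using that by (simp add: K_def)
    also have "\<dots> = 2 ^ j" using l by (simp add: power_add[symmetric])
    finally show ?thesis .
  qed
  have disj: "disjoint_family_on A K"
  proof -
    have ordered: "A m \<inter> A m' = {}" if "m < m'" for m m'
    proof -
      have "real (m * 2 ^ l) + L \<le> real (m' * 2 ^ l)"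
      proof -
        have "(m + 1) * 2 ^ l \<le> m' * 2 ^ l" using that by (intro mult_right_mono) auto
        hence "real ((m + 1) * 2 ^ l) \<le> real (m' * 2 ^ l)" by (simp only: of_nat_le_iff)
        thus ?thesis by (simp add: L_def algebra_simps)
      qed
      thus ?thesis by (auto simp: A_def simp del: of_nat_mult)
    qed
    show ?thesis unfolding disjoint_family_on_def
      using ordered by (metis Int_commute linorder_neqE_nat)
  qed
  have "prob {\<omega>\<in>space M. max_coeff X \<psi> j \<omega> \<le> r} \<le> prob {\<omega>\<in>space M. \<forall>m\<in>K. \<bar>wavelet_coeff X \<psi> j (m * 2 ^ l) \<omega>\<bar> \<le> r}"
  proof (rule finite_measure_mono)
    show "{\<omega>\<in>space M. max_coeff X \<psi> j \<omega> \<le> r} \<subseteq> {\<omega>\<in>space M. \<forall>m\<in>K. \<bar>wavelet_coeff X \<psi> j (m * 2 ^ l) \<omega>\<bar> \<le> r}"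
      using index unfolding max_coeff_def by (auto simp: Max_le_iff)
    have "finite K" by (simp add: K_def)
    thus "{\<omega>\<in>space M. \<forall>m\<in>K. \<bar>wavelet_coeff X \<psi> j (m * 2 ^ l) \<omega>\<bar> \<le> r} \<in> events"
      using index by measurable
  qed
  also have "\<dots> \<le> exp (- (tail_const * (\<sigma> * a / r powr \<alpha>)) * card K) + card K * (32 * (\<sigma> * (4 * C * 2 powr (- (real l * \<alpha>)))) / r powr \<alpha>)"
  proof (rule stable_approx_all_small[where f = "\<lambda>m. coeff_kernel j (m * 2 ^ l)" and A = A])
    show "finite K" "K \<noteq> {}" by (auto simp: K_def lessThan_empty_iff)
    show "stable_approx (coeff_kernel j (m * 2 ^ l)) (wavelet_coeff X \<psi> j (m * 2 ^ l))" if "m \<in> K" for m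
      using index[OF that] by (rule stable_approx_wavelet_coeff)
    show A: "A m \<in> sets borel" for m unfolding A_def by measurable
    show "ennreal (\<sigma> * a) \<le> lpow \<alpha> (\<lambda>x. coeff_kernel j (m * 2 ^ l) x * indicator (A m) x)" for m
      unfolding A_def using a \<sigma> by (subst lpow_coeff_kernel) (auto simp: \<sigma>_def[symmetric] L_def ennreal_mult intro!: mult_left_mono)
    show "lpow \<alpha> (\<lambda>x. coeff_kernel j (m * 2 ^ l) x * indicator (- A m) x) \<le> ennreal (\<sigma> * (4 * C * 2 powr (- (real l * \<alpha>))))" for m
    proof -
      have "- A m = {s. 2 ^ j * s + - real (m * 2 ^ l) \<in> - {- (L - 1)<..1}}" by (auto simp: A_def)
      hence "lpow \<alpha> (\<lambda>x. coeff_kernel j (m * 2 ^ l) x * indicator (- A m) x)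
        = ennreal \<sigma> * lpow \<alpha> (\<lambda>x. frac_psi x * indicator (- {- (L - 1)<..1}) x)"
        by (simp only: lpow_coeff_kernel[of "- {- (L - 1)<..1}"] \<sigma>_def) (subst lpow_coeff_kernel, auto)
      \<comment> \<open>Outside the window only the left tail counts, since \<open>frac_psi\<close>
        vanishes to the right of 1.\<close>
      also have "(\<lambda>x. frac_psi x * indicator (- {- (L - 1)<..1}) x) = (\<lambda>x. frac_psi x * indicator {..- (L - 1)} x)"
        using L by (auto simp: fun_eq_iff indicator_def frac_psi_eq_0)
      also have "ennreal \<sigma> * lpow \<alpha> \<dots> \<le> ennreal \<sigma> * ennreal (4 * C * 2 powr (- (real l * \<alpha>)))"
      proof (intro mult_left_mono order_trans[OF C(1)] ennreal_leI)
        have "(L - 1) powr (- \<alpha>) \<le> (L / 2) powr (- \<alpha>)" using L alpha by (intro powr_mono2') auto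
        also have "\<dots> = 2 powr \<alpha> * L powr (- \<alpha>)" using L by (simp add: powr_divide powr_minus field_simps)
        also have "\<dots> \<le> 4 * L powr (- \<alpha>)" using powr_mono[of \<alpha> 2 2] alpha by (intro mult_right_mono) auto
        also have "L powr (- \<alpha>) = 2 powr (- (real l * \<alpha>))" by (simp add: L_def powr_realpow[symmetric] powr_powr)
        finally have "(L - 1) powr (- \<alpha>) \<le> 4 * 2 powr (- (real l * \<alpha>))" .
        from mult_left_mono[OF this C(2)]
        show "C * (L - 1) powr (- \<alpha>) \<le> 4 * C * 2 powr (- (real l * \<alpha>))" by (simp only: mult.assoc mult.left_commute)
      qed (use L in auto)
      also have "\<dots> = ennreal (\<sigma> * (4 * C * 2 powr (- (real l * \<alpha>))))"
        using \<sigma> C(2) by (simp add: ennreal_mult)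
      finally show ?thesis .
    qed
    show "\<sigma> * a / r powr \<alpha> \<le> 4 - 2 powr \<alpha>" using small by (simp add: \<sigma>_def)
  qed (use \<sigma> a r C disj in auto)
  finally show ?thesis by (simp add: \<sigma>_def K_def)
qed

text \<open>The condition \<open>\<alpha> * \<epsilon> < 1\<close> ensures both
  \<open>\<delta> < 1\<close>, so that the spacing \<open>2 ^ l\<close> fits among the
  \<open>2 ^ j\<close> indices, and that the single-coefficient probability tends to 0, as the lower
  tail bound requires.\<close>

lemma AE_eventually_ge:
  assumes \<epsilon>: "0 < \<epsilon>" "\<alpha> * \<epsilon> < 1"
  shows "AE \<omega> in M. eventually (\<lambda>j. 2 powr (- (real j * (\<gamma> + \<epsilon>))) < max_coeff X \<psi> j \<omega>) sequentially"
proof -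
  \<comment> \<open>The coefficients are sampled at multiples of \<open>2 ^ l\<close> with \<open>2 ^ l\<close> about \<open>2 powr (\<delta> * j)\<close>. The remainders are
    negligible if \<open>\<epsilon> < \<delta>\<close>, and enough independent parts are left if \<open>\<delta> < \<alpha> * \<epsilon>\<close>; \<open>\<delta>\<close> is the midpoint.\<close>
  define \<eta> where "\<eta> = \<epsilon> * (\<alpha> - 1) / 2"
  define \<delta> where "\<delta> = \<epsilon> * (1 + \<alpha>) / 2"
  have \<eta>: "0 < \<eta>" using \<epsilon> alpha1 by (simp add: \<eta>_def)
  have \<delta>: "0 < \<delta>" "\<delta> < 1" "\<alpha> * \<epsilon> - \<delta> = \<eta>" "\<delta> - \<epsilon> = \<eta>"
  proof -
    show "0 < \<delta>" using \<epsilon> alpha1 by (simp add: \<delta>_def)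
    show 1: "\<alpha> * \<epsilon> - \<delta> = \<eta>" "\<delta> - \<epsilon> = \<eta>" by (simp_all add: \<delta>_def \<eta>_def field_simps)
    show "\<delta> < 1" using 1(1) \<eta> \<epsilon>(2) by linarith
  qed
  obtain C where C: "0 \<le> C" "\<And>R. 2 \<le> R \<Longrightarrow> lpow \<alpha> (\<lambda>x. frac_psi x * indicator {..- R} x) \<le> ennreal (C * R powr (- \<alpha>))"
    using lpow_frac_psi_tail[OF alpha(1) decay_exponent] by blast
  obtain a R0 where a: "0 < a" "2 \<le> R0" "\<And>R. R0 \<le> R \<Longrightarrow> ennreal a \<le> lpow \<alpha> (\<lambda>x. frac_psi x * indicator {- R<..1} x)"
    using lpow_frac_psi_truncated by blast
  define r where "r j = 2 powr (- (real j * (\<gamma> + \<epsilon>)))" for j :: nat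
  define l where "l j = nat \<lceil>\<delta> * real j\<rceil>" for j :: nat
  have l: "\<delta> * real j \<le> real (l j)" "real (l j) \<le> \<delta> * real j + 1" "l j \<le> j" for j
  proof -
    have "0 \<le> \<delta> * real j" using \<delta> by simp
    thus "\<delta> * real j \<le> real (l j)" "real (l j) \<le> \<delta> * real j + 1" unfolding l_def by linarith+
    have "\<delta> * real j \<le> real j" using \<delta> by (simp add: mult_left_le_one_le)
    thus "l j \<le> j" unfolding l_def by (simp add: ceiling_le_iff nat_le_iff)
  qed
  \<comment> \<open>Up to constants this is the probability that one coefficient exceeds
    \<open>r j\<close>; again \<open>\<alpha> * \<gamma> + 1 = \<alpha> * H\<close>.\<close>
  have q: "2 powr (- (real j * (\<alpha> * H))) / r j powr \<alpha> = 2 powr (real j * (\<alpha> * \<epsilon> - 1))" for j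
  proof -
    have "2 powr (- (real j * (\<alpha> * H))) / r j powr \<alpha> = 2 powr (- (real j * (\<alpha> * H)) - - (real j * (\<gamma> + \<epsilon>)) * \<alpha>)"
      by (simp only: r_def powr_powr powr_diff)
    also have "- (real j * (\<alpha> * H)) - - (real j * (\<gamma> + \<epsilon>)) * \<alpha> = real j * (\<alpha> * \<epsilon> - 1)"
      using alpha by (simp add: field_simps)
    finally show ?thesis .
  qed
  \<comment> \<open>The half compensates the ceiling in \<open>l\<close>, which can exceed
    \<open>\<delta> * j\<close> by up to 1 and so halve the number of sampled coefficients.\<close>
  define c where "c = tail_const * a / 2"
  have c: "0 < c" using tail_const_pos a by (simp add: c_def)
  define B where "B j = {\<omega>\<in>space M. max_coeff X \<psi> j \<omega> \<le> r j}" for j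
  have B: "B j \<in> events" for j
  proof -
    have "B j = {\<omega>\<in>space M. \<forall>k\<in>{0..<2^j}. \<bar>wavelet_coeff X \<psi> j k \<omega>\<bar> \<le> r j}"
      by (simp add: B_def max_coeff_def)
    also have "\<dots> \<in> events" by measurable
    finally show ?thesis .
  qed
  have lim: "filterlim (\<lambda>j. 2 powr (\<delta> * real j)) at_top sequentially"
    using \<delta>(1) by real_asymp
  have "eventually (\<lambda>j. 1 < \<delta> * real j) sequentially" using \<delta>(1) by real_asymp
  moreover have "eventually (\<lambda>j. R0 + 1 \<le> 2 powr (\<delta> * real j)) sequentially"
    using lim by (auto simp: filterlim_at_top)
  moreover have "eventually (\<lambda>j. 2 powr (real j * (\<alpha> * \<epsilon> - 1)) * a < 4 - 2 powr \<alpha>) sequentially"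
  proof (rule order_tendstoD(2))
    have "(\<lambda>j. 2 powr (real j * e)) \<longlonglongrightarrow> (0::real)" if "e < 0" for e :: real
    proof -
      have "2 powr (real j * e) = (2 powr e :: real) ^ j" for j
        by (subst mult.commute, subst powr_powr[symmetric], subst powr_realpow) auto
      moreover have "(\<lambda>j. (2 powr e :: real) ^ j) \<longlonglongrightarrow> 0"
        using that by (intro LIMSEQ_power_zero) (simp add: powr_less_one)
      ultimately show ?thesis by simp
    qed
    hence "(\<lambda>j. 2 powr (real j * (\<alpha> * \<epsilon> - 1))) \<longlonglongrightarrow> 0"
      using \<epsilon>(2) by simp
    from tendsto_mult[OF this tendsto_const[of a]] show "(\<lambda>j. 2 powr (real j * (\<alpha> * \<epsilon> - 1)) * a) \<longlonglongrightarrow> 0" by simp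
    show "0 < 4 - 2 powr \<alpha>" using alpha powr_less_mono[of \<alpha> 2 2] by auto
  qed
  ultimately have ev: "eventually (\<lambda>j. norm (prob (B j)) \<le> (1 / c + 128 * C) * (2 powr (- \<eta>)) ^ j) sequentially"
  proof eventually_elim
    case (elim j)
    define Q where "Q = 2 powr (real j * (\<alpha> * \<epsilon> - 1))"
    have Q: "0 < Q" by (simp add: Q_def)
    have pow: "(2::real) ^ (j - l j) = 2 powr (real j - real (l j))"
      using l(3)[of j] by (simp add: powr_realpow[symmetric] of_nat_diff)
    have "2 \<le> l j" using elim(1) l(1)[of j] by linarith
    have "2 powr (\<delta> * real j) \<le> 2 powr real (l j)" using l(1) by (intro powr_mono) auto
    hence R0: "R0 \<le> 2 ^ l j - 1" using elim(2) by (simp add: powr_realpow)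
    have "prob (B j) \<le> exp (- (tail_const * (Q * a)) * 2 ^ (j - l j)) + 2 ^ (j - l j) * (32 * (Q * (4 * C * 2 powr (- (real (l j) * \<alpha>)))))"

    proof -
      let ?P = "2 powr (- (real j * (\<alpha> * H)))"
      have q': "?P * x / r j powr \<alpha> = Q * x" "32 * (?P * x) / r j powr \<alpha> = 32 * (Q * x)" for x
        unfolding Q_def q[of j, symmetric] by simp_all
      have "0 < r j" by (simp add: r_def)
      moreover have "?P * a / r j powr \<alpha> \<le> 4 - 2 powr \<alpha>" using elim(3) by (simp only: q' Q_def)
      ultimately have "prob (B j) \<le> exp (- (tail_const * (?P * a / r j powr \<alpha>)) * 2 ^ (j - l j))
          + 2 ^ (j - l j) * (32 * (?P * (4 * C * 2 powr (- (real (l j) * \<alpha>)))) / r j powr \<alpha>)"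
        unfolding B_def by (intro prob_all_small[OF C(2,1) a(1) a(3)[OF R0] \<open>2 \<le> l j\<close> l(3)])
      thus ?thesis by (simp only: q')
    qed
    also have "exp (- (tail_const * (Q * a)) * 2 ^ (j - l j)) \<le> 1 / c * 2 powr (- \<eta> * real j)"
    proof -
      define x where "x = tail_const * (Q * a) * 2 ^ (j - l j)"
      have "c * 2 powr (\<eta> * real j) = tail_const * a * (Q * 2 powr (real j - (\<delta> * real j + 1)))"
      proof -
        have "Q * 2 powr (real j - (\<delta> * real j + 1)) = 2 powr (real j * (\<alpha> * \<epsilon> - \<delta>) - 1)"
          unfolding Q_def powr_add[symmetric] by (simp add: algebra_simps)
        also have "\<dots> = 2 powr (\<eta> * real j) / 2" using \<delta>(3) by (simp add: powr_diff mult.commute)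
        finally show ?thesis by (simp add: c_def)
      qed
      also have "\<dots> \<le> tail_const * a * (Q * 2 powr (real j - real (l j)))"
        using l(2)[of j] tail_const_pos a Q by (intro mult_left_mono powr_mono) auto
      also have "\<dots> = x" by (simp add: x_def pow)
      finally have x: "c * 2 powr (\<eta> * real j) \<le> x" .
      moreover have "0 < c * 2 powr (\<eta> * real j)" using c by simp
      ultimately have x0: "0 < x" by linarith
      \<comment> \<open>Since \<open>x\<close> grows geometrically in \<open>j\<close>, this crude
        bound is already summable.\<close>
      have "exp (- x) \<le> 1 / x"

      proof -
        have "x \<le> exp x" using exp_ge_add_one_self[of x] by linarith
        with x0 show ?thesis unfolding exp_minus inverse_eq_divide by (intro divide_left_mono) auto
      qed
      also have "\<dots> \<le> 1 / (c * 2 powr (\<eta> * real j))" using x c x0 by (intro divide_left_mono) auto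
      also have "\<dots> = 1 / c * 2 powr (- \<eta> * real j)" by (simp add: powr_minus divide_inverse)
      finally show ?thesis by (simp add: x_def)
    qed
    also have "2 ^ (j - l j) * (32 * (Q * (4 * C * 2 powr (- (real (l j) * \<alpha>))))) \<le> 128 * C * 2 powr (- \<eta> * real j)"
    proof -
      have "2 ^ (j - l j) * (32 * (Q * (4 * C * 2 powr (- (real (l j) * \<alpha>)))))
        = 128 * C * 2 powr (real j - real (l j) + real j * (\<alpha> * \<epsilon> - 1) + - (real (l j) * \<alpha>))"
        by (simp only: pow Q_def powr_add) simp
      also have "\<dots> \<le> 128 * C * 2 powr (- \<eta> * real j)"
      proof (intro mult_left_mono powr_mono)
        \<comment> \<open>The exponent is \<open>j \<alpha> \<epsilon> - l - l \<alpha>\<close>.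
          Dropping \<open>- l\<close> and using \<open>l \<ge> \<delta> j\<close> leaves
          \<open>- \<alpha> \<eta> j\<close>, which is at most \<open>- \<eta> j\<close> because
          \<open>\<alpha> > 1\<close>.\<close>
        have "\<delta> * real j * \<alpha> \<le> real (l j) * \<alpha>" using l(1) alpha by (intro mult_right_mono) auto
        moreover have "1 * (\<eta> * real j) \<le> \<alpha> * (\<eta> * real j)" using \<eta> alpha1 by (intro mult_right_mono) auto
        moreover have "\<alpha> * (\<eta> * real j) = \<delta> * real j * \<alpha> - real j * (\<alpha> * \<epsilon>)"
          unfolding \<delta>(4)[symmetric] by (simp add: algebra_simps)
        ultimately show "real j - real (l j) + real j * (\<alpha> * \<epsilon> - 1) + - (real (l j) * \<alpha>) \<le> - \<eta> * real j"
          by (simp add: algebra_simps)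
      qed (use C in auto)
      finally show ?thesis .
    qed
    finally have "prob (B j) \<le> (1 / c + 128 * C) * 2 powr (- \<eta> * real j)" by (simp add: distrib_right)
    also have "2 powr (- \<eta> * real j) = (2 powr (- \<eta>)) ^ j"
      by (subst powr_powr[symmetric], subst powr_realpow) auto
    finally show ?case by simp
  qed
  have "2 powr (- \<eta>) < (1::real)" using \<eta> by (simp add: powr_less_one)
  hence "summable (\<lambda>j. (1 / c + 128 * C) * (2 powr (- \<eta>)) ^ j)"
    by (intro summable_mult summable_geometric) auto
  hence "summable (\<lambda>j. prob (B j))" using ev by (rule summable_comparison_test_ev[rotated])
  hence "AE \<omega> in M. eventually (\<lambda>j. \<omega> \<in> space M - B j) sequentially"
    by (intro borel_cantelli_AE1 B) (auto simp: emeasure_eq_measure)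
  thus ?thesis
    by eventually_elim (auto simp: B_def r_def elim!: eventually_mono)
qed

lemma AE_log_max_coeff:
  "AE \<omega> in M. (\<lambda>j. ln (max_coeff X \<psi> j \<omega>) / (real j * ln 2)) \<longlonglongrightarrow> - \<gamma>"
proof -
  \<comment> \<open>A countable sequence of margins, so that the exceptional null sets can be
    united; the \<open>+ 2\<close> keeps \<open>\<alpha> * \<epsilon> n < 1\<close> even for
    \<open>n = 0\<close>.\<close>
  define \<epsilon> where "\<epsilon> n = 1 / (\<alpha> * (real n + 2))" for n :: nat
  have \<epsilon>: "0 < \<epsilon> n" "\<alpha> * \<epsilon> n < 1" for n using alpha by (auto simp: \<epsilon>_def)
  have "\<epsilon> \<longlonglongrightarrow> 0" unfolding \<epsilon>_def using alpha(1) by real_asymp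
  have "AE \<omega> in M. \<forall>n. eventually (\<lambda>j. max_coeff X \<psi> j \<omega> \<le> 2 powr (real j * (\<epsilon> n - \<gamma>))) sequentially"
    by (subst AE_all_countable) (intro allI AE_eventually_le \<epsilon>)
  moreover have "AE \<omega> in M. \<forall>n. eventually (\<lambda>j. 2 powr (- (real j * (\<gamma> + \<epsilon> n))) < max_coeff X \<psi> j \<omega>) sequentially"
    by (subst AE_all_countable) (intro allI AE_eventually_ge \<epsilon>)
  ultimately show ?thesis
  proof eventually_elim
    case (elim \<omega>)
    show ?case
    proof (rule tendstoI)
      fix e :: real assume "0 < e"
      from order_tendstoD(2)[OF \<open>\<epsilon> \<longlonglongrightarrow> 0\<close> this] obtain n where n: "\<epsilon> n < e"
        using eventually_happens'[OF sequentially_bot] by blast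
      from elim(1)[rule_format, of n] elim(2)[rule_format, of n] eventually_gt_at_top[of 0]
      show "eventually (\<lambda>j. dist (ln (max_coeff X \<psi> j \<omega>) / (real j * ln 2)) (- \<gamma>) < e) sequentially"
      proof eventually_elim
        case (elim j)
        define D where "D = max_coeff X \<psi> j \<omega>"
        \<comment> \<open>The lower bound makes the maximum eventually positive, so the default
          value of \<open>ln 0\<close> never influences the limit.\<close>
        have D: "0 < D" using elim(2) unfolding D_def by (rule order.strict_trans[rotated]) simp
        have j: "0 < real j * ln 2" using elim(3) by simp
        have "ln D \<le> ln (2 powr (real j * (\<epsilon> n - \<gamma>)))" using elim(1) D by (subst ln_le_cancel_iff) (auto simp: D_def)
        hence "ln D \<le> (\<epsilon> n - \<gamma>) * (real j * ln 2)" by (simp add: ln_powr mult_ac)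
        hence "ln D / (real j * ln 2) \<le> \<epsilon> n - \<gamma>" using j by (simp only: pos_divide_le_eq)
        moreover have "ln (2 powr (- (real j * (\<gamma> + \<epsilon> n)))) \<le> ln D" using elim(2) D by (subst ln_le_cancel_iff) (auto simp: D_def)
        hence "- (\<gamma> + \<epsilon> n) * (real j * ln 2) \<le> ln D" by (simp add: ln_powr algebra_simps)
        hence "- (\<gamma> + \<epsilon> n) \<le> ln D / (real j * ln 2)" using j by (simp only: pos_le_divide_eq)
        ultimately show ?case using n unfolding D_def dist_real_def by linarith
      qed
    qed
  qed
qed

end

theorem theorem1p1:
  fixes M :: "'a measure" and \<alpha> H :: real
    and Z :: "real set \<Rightarrow> 'a \<Rightarrow> real" and X :: "real \<Rightarrow> 'a \<Rightarrow> real" and \<psi> :: "real \<Rightarrow> real"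
  assumes "1 < \<alpha>" and "\<alpha> < 2" and "1 / \<alpha> < H" and "H < 1"
    and "sas_random_measure M \<alpha> Z"
    and "continuous_lfsm M H \<alpha> Z X"
    and "continuous_on UNIV \<psi>"
    and "\<exists>x. \<psi> x \<noteq> 0"
    and "\<And>x. x \<notin> {0..1} \<Longrightarrow> \<psi> x = 0"
    and "(\<integral>s. \<psi> s \<partial>lborel) = 0"
    and "(\<integral>s. s * \<psi> s \<partial>lborel) = 0"
  shows "AE \<omega> in M. (\<lambda>j. alpha_hat H X \<psi> j \<omega>) \<longlonglongrightarrow> \<alpha>"
proof -
  interpret sas_random_measure M \<alpha> Z by fact
  have "0 < 1 / \<alpha>" using assms(1) by simp
  interpret lfsm_wavelet M \<alpha> Z \<psi> H X
    by (unfold_locales; (fact assms | (use assms(1-4) \<open>0 < 1 / \<alpha>\<close> in linarith)))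
  from AE_log_max_coeff show ?thesis
  proof eventually_elim
    case (elim \<omega>)
    \<comment> \<open>The denominator tends to \<open>H - \<gamma> = 1 / \<alpha>\<close>, which is
      nonzero, so the value of division by 0 does not affect the limit.\<close>
    have "(\<lambda>j. 1 / (H + ln (max_coeff X \<psi> j \<omega>) / (real j * ln 2))) \<longlonglongrightarrow> 1 / (H + - (H - 1 / \<alpha>))"
      using assms(1) by (intro tendsto_divide tendsto_add tendsto_const elim) auto
    thus ?case by (simp add: alpha_hat_def)
  qed
qed

end
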